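(* Let $(\mathcal{M}, g)$ be a (smooth) Riemannian manifold and let $\omega$ be an arbitrary (smooth) semi-calibration of degree $2$ in $(\mathcal{M}, g)$. For any point $x_0 \in \mathcal{M}$ there exist a neighbourhood $\mathcal{U}$ of $x_0$ in $\mathcal{M}$, a (smooth) non-degenerate differential form $\Omega$ of degree $2$ and a (smooth) Riemannian metric $g_J$, where both $\Omega$ and $g_J$ are defined on $\mathcal{U}$ if $\dim\mathcal{M}$ is even, and on $\mathcal{U} \times I$ for some interval $I \subset \mathbb{R}$ containing $0$ if $\dim \mathcal{M}$ is odd, such that: (1) $\Omega$ is a semi-calibration in $(\mathcal{U}, g_J)$ [in $(\mathcal{U} \times I, g_J)$ if $\dim\mathcal{M}$ is odd]; (2) $\Omega$ and $g_J$ uniquely define an almost complex structure $J$ on $\mathcal{U}$ [on $\mathcal{U} \times I$ if $\dim\mathcal{M}$ is odd] such that $g_J(\cdot, \cdot) = \Omega(\cdot, J\,\cdot)$; (3) for every $x \in \mathcal{U}$, any (oriented) $2$-plane in $(T_x \mathcal{M}, g)$ that is calibrated by $\omega(x)$ is also calibrated by $\Omega(x)$ in $(T_x \mathcal{M}, g_J)$ [if $\dim \mathcal{M}$ is odd: it is calibrated by $\Omega(x,0)$ in $(T_{(x,0)}(\mathcal{M} \times \mathbb{R}), g_J)$]. In particular, for every $x \in \mathcal{U}$, any $2$-plane in $(T_x \mathcal{M}, g)$ that is calibrated by $\omega(x)$ is $J(x)$-holomorphic [$J(x,0)$-holomorphic if $\dim\mathcal{M}$ is odd].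
   Context: Let $(\mathcal{M}, g)$ be a Riemannian manifold and $\phi$ a differential form of degree $k$ on $\mathcal{M}$. The comass of $\phi$ with respect to $g$ is $$\|\phi\|^* := \sup\{\langle \phi_x, \xi_x\rangle : x \in \mathcal{M},\ \xi_x \text{ is a unit simple } k\text{-vector in } T_x\mathcal{M}\}.$$ Unit simple $k$-vectors in $T_x\mathcal{M}$ (i.e. $v_1 \wedge \dots \wedge v_k$ with $v_1,\dots,v_k$ $g$-orthonormal) are identified with oriented $k$-dimensional planes in $T_x\mathcal{M}$. A semi-calibration of degree $k$ in $(\mathcal{M}, g)$ is a $k$-form of comass $\|\phi\|^* = 1$ (no closedness is required). An oriented $k$-plane $\xi$ in $(T_x\mathcal{M}, g)$, viewed as a unit simple $k$-vector, is calibrated by $\phi(x)$ if $\langle \phi_x, \xi\rangle = 1$. An almost complex structure $J$ on a manifold is a smooth field of endomorphisms of the tangent spaces with $J^2 = -\mathrm{Id}$. A $2$-plane in a tangent space is $J$-holomorphic if it is invariant under $J$ and positively oriented with respect to the orientation induced by $J$, i.e. it is oriented by $v \wedge Jv$ for $v \neq 0$ in the plane. When $\dim\mathcal{M}$ is odd, $T_x\mathcal{M}$ is regarded as the subspace $T_x\mathcal{M} \times \{0\}$ of $T_{(x,0)}(\mathcal{M} \times \mathbb{R})$. *)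

theory Defs
  imports "HOL-Analysis.Analysis"
begin

subsection \<open>Smooth maps between Euclidean spaces\<close>

text \<open>\<open>higher_differentiable_on S f n\<close> expresses that \<open>f\<close> is of class \<open>C\<^sup>n\<close>; it is only used for
  open \<open>S\<close>. The derivatives are the iterated directional derivatives.\<close>

fun higher_differentiable_on ::
  "'b::real_normed_vector set \<Rightarrow> ('b \<Rightarrow> 'c::real_normed_vector) \<Rightarrow> nat \<Rightarrow> bool" where
  "higher_differentiable_on S f 0 \<longleftrightarrow> continuous_on S f"
| "higher_differentiable_on S f (Suc n) \<longleftrightarrow>
     (\<forall>x\<in>S. f differentiable (at x)) \<and>
     (\<forall>v. higher_differentiable_on S (\<lambda>x. frechet_derivative f (at x) v) n)"

definition smooth_on :: "'b::real_normed_vector set \<Rightarrow> ('b \<Rightarrow> 'c::real_normed_vector) \<Rightarrow> bool" where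
  "smooth_on S f \<longleftrightarrow> (\<forall>n. higher_differentiable_on S f n)"


subsection \<open>Smooth manifolds\<close>

text \<open>A chart is a domain together with a map that is only relevant on that domain.\<close>

type_synonym ('a, 'e) chart = "'a set \<times> ('a \<Rightarrow> 'e)"

abbreviation chart_dom :: "('a, 'e) chart \<Rightarrow> 'a set" where
  "chart_dom c \<equiv> fst c"

abbreviation chart_map :: "('a, 'e) chart \<Rightarrow> 'a \<Rightarrow> 'e" where
  "chart_map c \<equiv> snd c"

definition chart_inv :: "('a, 'e) chart \<Rightarrow> 'e \<Rightarrow> 'a" where
  "chart_inv c = inv_into (chart_dom c) (chart_map c)"

text \<open>A smooth manifold is given by an atlas \<open>A\<close>, which need not be maximal; its underlying space is
  the union of the chart domains, an open subset of the Hausdorff, second countable type \<open>'a\<close>.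
  Its dimension is \<open>DIM('e)\<close>.\<close>

definition manifold_carrier :: "('a, 'e) chart set \<Rightarrow> 'a set" where
  "manifold_carrier A = (\<Union>c\<in>A. chart_dom c)"

definition smooth_manifold ::
  "('a::{t2_space,second_countable_topology}, 'e::euclidean_space) chart set \<Rightarrow> bool" where
  "smooth_manifold A \<longleftrightarrow>
     (\<forall>c\<in>A. open (chart_dom c) \<and> open (chart_map c ` chart_dom c) \<and>
        homeomorphism (chart_dom c) (chart_map c ` chart_dom c) (chart_map c) (chart_inv c)) \<and>
     (\<forall>c\<in>A. \<forall>d\<in>A. smooth_on (chart_map c ` (chart_dom c \<inter> chart_dom d)) (chart_map d \<circ> chart_inv c))"

text \<open>The product atlas on \<open>M \<times> \<real>\<close>.\<close>

definition times_line :: "('a, 'e) chart set \<Rightarrow> ('a \<times> real, 'e \<times> real) chart set" where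
  "times_line A = (\<lambda>c. (chart_dom c \<times> UNIV, \<lambda>(x, t). (chart_map c x, t))) ` A"


subsection \<open>Tangent spaces\<close>

text \<open>A tangent vector at \<open>x\<close> is the family of its coordinate vectors in the charts around \<open>x\<close>,
  which transform into each other by the derivatives of the transition maps (and it is \<open>0\<close> at all
  other indices). The vector space structure is pointwise in the index. If \<open>U\<close> is an
  open subset of the manifold and \<open>x \<in> U\<close>, then \<open>tangent_space A x\<close> also serves as the tangent
  space of \<open>U\<close> at \<open>x\<close>.\<close>

type_synonym ('a, 'e) tvec = "('a, 'e) chart \<Rightarrow> 'e"

definition transition_deriv ::
  "('a, 'e::euclidean_space) chart \<Rightarrow> ('a, 'e) chart \<Rightarrow> 'a \<Rightarrow> 'e \<Rightarrow> 'e" where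
  "transition_deriv c d x = frechet_derivative (chart_map d \<circ> chart_inv c) (at (chart_map c x))"

definition tangent_space ::
  "('a, 'e::euclidean_space) chart set \<Rightarrow> 'a \<Rightarrow> ('a, 'e) tvec set" where
  "tangent_space A x =
     {v. (\<forall>c. \<not> (c \<in> A \<and> x \<in> chart_dom c) \<longrightarrow> v c = 0) \<and>
         (\<forall>c\<in>A. \<forall>d\<in>A. x \<in> chart_dom c \<and> x \<in> chart_dom d \<longrightarrow> v d = transition_deriv c d x (v c))}"

definition zero_tvec :: "('a, 'e::euclidean_space) tvec" where
  "zero_tvec = (\<lambda>c. 0)"

definition neg_tvec :: "('a, 'e::euclidean_space) tvec \<Rightarrow> ('a, 'e) tvec" where
  "neg_tvec v = (\<lambda>c. - v c)"

definition lincomb ::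
  "real \<Rightarrow> ('a, 'e::euclidean_space) tvec \<Rightarrow> real \<Rightarrow> ('a, 'e) tvec \<Rightarrow> ('a, 'e) tvec" where
  "lincomb a u b v = (\<lambda>c. a *\<^sub>R u c + b *\<^sub>R v c)"

text \<open>The tangent vector at \<open>x\<close> whose coordinate vector in the chart \<open>c\<close> is \<open>u\<close>; for constant \<open>u\<close>
  and varying \<open>x\<close> this is a constant-coefficient combination of the coordinate vector fields.\<close>

definition coord_tvec ::
  "('a, 'e::euclidean_space) chart set \<Rightarrow> ('a, 'e) chart \<Rightarrow> 'a \<Rightarrow> 'e \<Rightarrow> ('a, 'e) tvec" where
  "coord_tvec A c x u =
     (\<lambda>d. if d \<in> A \<and> x \<in> chart_dom d then transition_deriv c d x u else 0)"

text \<open>The differential at \<open>x\<close> of a smooth map \<open>f\<close> between manifolds with atlases \<open>A\<close> and \<open>B\<close>. It does not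
  depend on the chart chosen around \<open>x\<close>.\<close>

definition differential ::
  "('a, 'e::euclidean_space) chart set \<Rightarrow> ('b, 'f::euclidean_space) chart set \<Rightarrow>
   ('a \<Rightarrow> 'b) \<Rightarrow> 'a \<Rightarrow> ('a, 'e) tvec \<Rightarrow> ('b, 'f) tvec" where
  "differential A B f x v =
     (\<lambda>d. if d \<in> B \<and> f x \<in> chart_dom d
          then (let c = (SOME c. c \<in> A \<and> x \<in> chart_dom c)
                in frechet_derivative (chart_map d \<circ> f \<circ> chart_inv c) (at (chart_map c x)) (v c))
          else 0)"

text \<open>The identification of \<open>T\<^sub>x M\<close> with the subspace \<open>T\<^sub>x M \<times> {0}\<close> of the tangent space of \<open>M \<times> \<real>\<close>
  at \<open>(x, 0)\<close>.\<close>

definition tangent_incl ::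
  "('a, 'e::euclidean_space) chart set \<Rightarrow> 'a \<Rightarrow> ('a, 'e) tvec \<Rightarrow> ('a \<times> real, 'e \<times> real) tvec" where
  "tangent_incl A x = differential A (times_line A) (\<lambda>y. (y, 0)) x"


subsection \<open>Tensor fields over an open subset \<open>S\<close> of a manifold\<close>

text \<open>Values of the fields at points outside \<open>S\<close>, or at arguments that are not tangent
  vectors, are irrelevant.\<close>

type_synonym ('a, 'e) tensor2 = "'a \<Rightarrow> ('a, 'e) tvec \<Rightarrow> ('a, 'e) tvec \<Rightarrow> real"
type_synonym ('a, 'e) endo_field = "'a \<Rightarrow> ('a, 'e) tvec \<Rightarrow> ('a, 'e) tvec"

definition smooth_tensor2 ::
  "('a, 'e::euclidean_space) chart set \<Rightarrow> 'a set \<Rightarrow> ('a, 'e) tensor2 \<Rightarrow> bool" where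
  "smooth_tensor2 A S B \<longleftrightarrow>
     (\<forall>x\<in>S. \<forall>u\<in>tangent_space A x. \<forall>v\<in>tangent_space A x. \<forall>w\<in>tangent_space A x. \<forall>a b.
        B x (lincomb a u b v) w = a * B x u w + b * B x v w \<and>
        B x w (lincomb a u b v) = a * B x w u + b * B x w v) \<and>
     (\<forall>c\<in>A. \<forall>u v. smooth_on (chart_map c ` (chart_dom c \<inter> S))
        (\<lambda>y. B (chart_inv c y) (coord_tvec A c (chart_inv c y) u) (coord_tvec A c (chart_inv c y) v)))"

definition riemannian_metric ::
  "('a, 'e::euclidean_space) chart set \<Rightarrow> 'a set \<Rightarrow> ('a, 'e) tensor2 \<Rightarrow> bool" where
  "riemannian_metric A S g \<longleftrightarrow> smooth_tensor2 A S g \<and>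
     (\<forall>x\<in>S. \<forall>u\<in>tangent_space A x. \<forall>v\<in>tangent_space A x. g x u v = g x v u) \<and>
     (\<forall>x\<in>S. \<forall>u\<in>tangent_space A x. u \<noteq> zero_tvec \<longrightarrow> g x u u > 0)"

definition two_form ::
  "('a, 'e::euclidean_space) chart set \<Rightarrow> 'a set \<Rightarrow> ('a, 'e) tensor2 \<Rightarrow> bool" where
  "two_form A S \<phi> \<longleftrightarrow> smooth_tensor2 A S \<phi> \<and>
     (\<forall>x\<in>S. \<forall>u\<in>tangent_space A x. \<phi> x u u = 0)"

definition nondegenerate ::
  "('a, 'e::euclidean_space) chart set \<Rightarrow> 'a set \<Rightarrow> ('a, 'e) tensor2 \<Rightarrow> bool" where
  "nondegenerate A S \<phi> \<longleftrightarrow>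
     (\<forall>x\<in>S. \<forall>u\<in>tangent_space A x. (\<forall>v\<in>tangent_space A x. \<phi> x u v = 0) \<longrightarrow> u = zero_tvec)"

definition almost_complex_structure ::
  "('a, 'e::euclidean_space) chart set \<Rightarrow> 'a set \<Rightarrow> ('a, 'e) endo_field \<Rightarrow> bool" where
  "almost_complex_structure A S J \<longleftrightarrow>
     (\<forall>x\<in>S. \<forall>u\<in>tangent_space A x.
        J x u \<in> tangent_space A x \<and> J x (J x u) = neg_tvec u \<and>
        (\<forall>v\<in>tangent_space A x. \<forall>a b. J x (lincomb a u b v) = lincomb a (J x u) b (J x v))) \<and>
     (\<forall>c\<in>A. \<forall>u. smooth_on (chart_map c ` (chart_dom c \<inter> S))
        (\<lambda>y. J (chart_inv c y) (coord_tvec A c (chart_inv c y) u) c))"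

text \<open>The relation \<open>g(\<cdot>, \<cdot>) = \<Omega>(\<cdot>, J \<cdot>)\<close>.\<close>

definition compatible_triple ::
  "('a, 'e::euclidean_space) chart set \<Rightarrow> 'a set \<Rightarrow>
   ('a, 'e) tensor2 \<Rightarrow> ('a, 'e) tensor2 \<Rightarrow> ('a, 'e) endo_field \<Rightarrow> bool" where
  "compatible_triple A S \<Omega> g J \<longleftrightarrow>
     (\<forall>x\<in>S. \<forall>u\<in>tangent_space A x. \<forall>v\<in>tangent_space A x. g x u v = \<Omega> x u (J x v))"

text \<open>Uniqueness is meant as a field over \<open>S\<close>, see the remark on irrelevant values above.\<close>

definition uniquely_defines_acs ::
  "('a, 'e::euclidean_space) chart set \<Rightarrow> 'a set \<Rightarrow>
   ('a, 'e) tensor2 \<Rightarrow> ('a, 'e) tensor2 \<Rightarrow> ('a, 'e) endo_field \<Rightarrow> bool" where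
  "uniquely_defines_acs A S \<Omega> g J \<longleftrightarrow>
     almost_complex_structure A S J \<and> compatible_triple A S \<Omega> g J \<and>
     (\<forall>J'. almost_complex_structure A S J' \<and> compatible_triple A S \<Omega> g J' \<longrightarrow>
        (\<forall>x\<in>S. \<forall>u\<in>tangent_space A x. J' x u = J x u))"


subsection \<open>Comass, semi-calibrations and oriented planes\<close>

text \<open>A unit simple 2-vector is \<open>u \<and> v\<close> with \<open>u, v\<close> orthonormal, and its pairing with a 2-form is the
  value of the form at \<open>(u, v)\<close>.\<close>

definition orthonormal_pair ::
  "(('a, 'e::euclidean_space) tvec \<Rightarrow> ('a, 'e) tvec \<Rightarrow> real) \<Rightarrow>
   ('a, 'e) tvec \<Rightarrow> ('a, 'e) tvec \<Rightarrow> bool" where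
  "orthonormal_pair gx u v \<longleftrightarrow> gx u u = 1 \<and> gx v v = 1 \<and> gx u v = 0"

text \<open>The supremum is taken in the extended reals, so that it is meaningful for unbounded forms, and
  it is \<open>-\<infinity>\<close> (rather than an unspecified real) if there are no 2-planes at all.\<close>

definition comass ::
  "('a, 'e::euclidean_space) chart set \<Rightarrow> 'a set \<Rightarrow> ('a, 'e) tensor2 \<Rightarrow> ('a, 'e) tensor2 \<Rightarrow> ereal" where
  "comass A S g \<phi> =
     Sup {ereal (\<phi> x u v) | x u v. x \<in> S \<and> u \<in> tangent_space A x \<and> v \<in> tangent_space A x \<and>
            orthonormal_pair (g x) u v}"

definition semi_calibration ::
  "('a, 'e::euclidean_space) chart set \<Rightarrow> 'a set \<Rightarrow> ('a, 'e) tensor2 \<Rightarrow> ('a, 'e) tensor2 \<Rightarrow> bool" where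
  "semi_calibration A S g \<phi> \<longleftrightarrow> two_form A S \<phi> \<and> comass A S g \<phi> = 1"

text \<open>An oriented 2-plane is represented, independently of any metric, by the set of all
  its positively oriented bases.\<close>

definition oriented_plane_of ::
  "('a, 'e::euclidean_space) tvec \<Rightarrow> ('a, 'e) tvec \<Rightarrow> (('a, 'e) tvec \<times> ('a, 'e) tvec) set" where
  "oriented_plane_of u v =
     {(lincomb a u b v, lincomb c u d v) | a b c d. a * d - b * c > 0}"

definition oriented_planes ::
  "('a, 'e::euclidean_space) chart set \<Rightarrow> 'a \<Rightarrow> (('a, 'e) tvec \<times> ('a, 'e) tvec) set set" where
  "oriented_planes A x =
     {oriented_plane_of u v | u v. u \<in> tangent_space A x \<and> v \<in> tangent_space A x \<and>
        (\<forall>a b. lincomb a u b v = zero_tvec \<longrightarrow> a = 0 \<and> b = 0)}"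

definition plane_vectors ::
  "(('a, 'e::euclidean_space) tvec \<times> ('a, 'e) tvec) set \<Rightarrow> ('a, 'e) tvec set" where
  "plane_vectors P = {lincomb a u b v | a b u v. (u, v) \<in> P}"

text \<open>The unit simple 2-vector of \<open>P\<close> with respect to the inner product \<open>gx\<close> is \<open>u \<and> v\<close> for any
  positively oriented orthonormal basis \<open>(u, v)\<close> of \<open>P\<close>.\<close>

definition calibrated_plane ::
  "(('a, 'e::euclidean_space) tvec \<Rightarrow> ('a, 'e) tvec \<Rightarrow> real) \<Rightarrow>
   (('a, 'e) tvec \<Rightarrow> ('a, 'e) tvec \<Rightarrow> real) \<Rightarrow> (('a, 'e) tvec \<times> ('a, 'e) tvec) set \<Rightarrow> bool" where
  "calibrated_plane gx \<phi>x P \<longleftrightarrow> (\<exists>(u, v)\<in>P. orthonormal_pair gx u v \<and> \<phi>x u v = 1)"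

definition holomorphic_plane ::
  "(('a, 'e::euclidean_space) tvec \<Rightarrow> ('a, 'e) tvec) \<Rightarrow>
   (('a, 'e) tvec \<times> ('a, 'e) tvec) set \<Rightarrow> bool" where
  "holomorphic_plane Jx P \<longleftrightarrow>
     (\<forall>v\<in>plane_vectors P. Jx v \<in> plane_vectors P) \<and>
     (\<forall>v\<in>plane_vectors P. v \<noteq> zero_tvec \<longrightarrow> (v, Jx v) \<in> P)"

text \<open>The plane \<open>P\<close> of \<open>T\<^sub>x M\<close>, regarded as a plane of the tangent space of \<open>M \<times> \<real>\<close> at \<open>(x, 0)\<close>.\<close>

definition plane_incl ::
  "('a, 'e::euclidean_space) chart set \<Rightarrow> 'a \<Rightarrow> (('a, 'e) tvec \<times> ('a, 'e) tvec) set \<Rightarrow>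
   (('a \<times> real, 'e \<times> real) tvec \<times> ('a \<times> real, 'e \<times> real) tvec) set" where
  "plane_incl A x P = map_prod (tangent_incl A x) (tangent_incl A x) ` P"

end

theory Submission imports Defs begin

text \<open>In a chart let \<open>G\<close> and \<open>W\<close> be the matrices of \<open>g\<close> and \<open>\<omega>\<close>. Since \<open>\<omega>\<close> has comass \<open>1\<close>, an orthonormal pair
  \<open>u, v\<close> with \<open>\<omega>(u, v) = 1\<close> maximises \<open>\<omega>\<close>, and the first-order condition reads \<open>W u = G v\<close>,
  \<open>W v = - G u\<close>. Fix a constant complex structure \<open>J\<^sub>0\<close> such that \<open>T = W + J\<^sub>0 G\<close> is invertible at the
  given point, hence nearby, and put \<open>J = T\<^sup>-\<^sup>1 J\<^sub>0 T\<close>. This is a smooth almost complex structure, as it is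
  rational in the entries of \<open>G\<close> and \<open>W\<close>. On a calibrated pair \<open>T v = J\<^sub>0 G v - G u = J\<^sub>0 T u\<close>, so \<open>J u = v\<close>.
  Now \<open>g\<^sub>J(u, v) = (g(u, v) + g(J u, J v)) / 2\<close> and \<open>\<Omega>(u, v) = g\<^sub>J(J u, v)\<close> have all required properties.
  If the dimension is odd, the same is done in the product chart of \<open>M \<times> \<real>\<close> with \<open>g + dt\<^sup>2\<close> and the
  pullback of \<open>\<omega>\<close>.\<close>

subsection \<open>Calculus of higher derivatives\<close>

text \<open>The obstacle is smoothness across points where \<open>\<omega>\<close> changes type: the
  eigenspace of \<open>\<omega>\<close> relative to \<open>g\<close> that carries the calibrated
  planes may jump in dimension, and \<open>\<omega>\<close> may degenerate, so a spectral or polar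
  decomposition of \<open>\<omega>\<close> need not give a smooth \<open>J\<close>. The formula for
  \<open>J\<close> avoids any decomposition: it uses the entries of \<open>G\<close> and
  \<open>W\<close>, a constant matrix and one inversion, and it sends \<open>u\<close> to
  \<open>v\<close> on a calibrated pair whatever \<open>J\<^sub>0\<close> is. The freedom in
  \<open>J\<^sub>0\<close> is spent on invertibility. As
  \<open>T = (W G\<^sup>-\<^sup>1 + J\<^sub>0) G\<close>, a complex structure transversal to an
  arbitrary endomorphism is required. In even dimension it is found one coordinate plane at a time,
  passing to a Schur complement. The first-order condition is an identity against all test vectors,
  so it passes from \<open>M\<close> to \<open>M \<times> \<real>\<close> without a comass estimate
  for the pulled back form.\<close>

lemma higher_differentiable_on_subset:
  "higher_differentiable_on S f n \<Longrightarrow> T \<subseteq> S \<Longrightarrow> higher_differentiable_on T f n"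
  by (induction n arbitrary: f) (auto intro: continuous_on_subset)

lemma frechet_derivative_cong_open:
  assumes "open S" "x \<in> S" "\<And>y. y \<in> S \<Longrightarrow> f y = g y"
  shows "frechet_derivative f (at x) = frechet_derivative g (at x)"
proof -
  have "(f has_derivative D) (at x) \<longleftrightarrow> (g has_derivative D) (at x)" for D
    using has_derivative_transform_within_open[OF _ assms(1,2)] assms(3) by metis
  then show ?thesis by (simp add: frechet_derivative_def)
qed

lemma differentiable_cong_open:
  assumes "open S" "x \<in> S" "\<And>y. y \<in> S \<Longrightarrow> f y = g y" "f differentiable (at x)"
  shows "g differentiable (at x)"
  using assms unfolding differentiable_def
  by (metis has_derivative_transform_within_open)

lemma higher_differentiable_on_cong:
  assumes "open S" "\<And>y. y \<in> S \<Longrightarrow> f y = g y" "higher_differentiable_on S f n"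
  shows "higher_differentiable_on S g n"
  using assms(2,3)
proof (induction n arbitrary: f g)
  case 0
  then show ?case by (auto cong: continuous_on_cong)
next
  case (Suc n)
  have "higher_differentiable_on S (\<lambda>x. frechet_derivative g (at x) v) n" for v
    by (rule Suc.IH[of "\<lambda>x. frechet_derivative f (at x) v"])
       (use Suc.prems frechet_derivative_cong_open[OF assms(1) _ Suc.prems(1)] in auto)
  with Suc.prems show ?case
    using differentiable_cong_open[OF assms(1) _ Suc.prems(1)] by auto
qed

text \<open>The \<open>Suc\<close> clause speaks of differentiability and of the derivatives, so
  lowering the order is an induction whose base case is that differentiable maps are
  continuous.\<close>

lemma higher_differentiable_on_Suc_imp:
  "higher_differentiable_on S f (Suc n) \<Longrightarrow> higher_differentiable_on S f n"
proof (induction n arbitrary: f)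
  case 0
  then show ?case
    by (auto intro!: differentiable_imp_continuous_on differentiable_at_imp_differentiable_on)
qed auto

text \<open>Lets the rules below work with an explicit derivative \<open>D\<close>. Openness of
  \<open>S\<close> makes it harmless to exchange \<open>D\<close> and
  \<open>frechet_derivative\<close> on \<open>S\<close> at the next order.\<close>

lemma higher_differentiable_on_SucI:
  assumes "open S" "\<And>x. x \<in> S \<Longrightarrow> (f has_derivative D x) (at x)"
    "\<And>v. higher_differentiable_on S (\<lambda>x. D x v) n"
  shows "higher_differentiable_on S f (Suc n)"
proof -
  have "D x = frechet_derivative f (at x)" if "x \<in> S" for x
    using frechet_derivative_at[OF assms(2)[OF that]] .
  then have "higher_differentiable_on S (\<lambda>x. frechet_derivative f (at x) v) n" for v
    by (intro higher_differentiable_on_cong[OF assms(1) _ assms(3)[of v]]) simp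
  then show ?thesis
    using assms(2) by (auto simp: differentiable_def)
qed

lemma higher_differentiable_on_has_derivative:
  assumes "higher_differentiable_on S f (Suc n)" "x \<in> S"
  shows "(f has_derivative frechet_derivative f (at x)) (at x)"
  using assms by (simp add: frechet_derivative_works)

lemma higher_differentiable_on_const:
  "higher_differentiable_on S (\<lambda>x. c) n"
  by (induction n arbitrary: c) (auto simp: frechet_derivative_const)

lemma higher_differentiable_on_linear:
  assumes "bounded_linear L"
  shows "higher_differentiable_on S L n"
proof (cases n)
  case 0
  then show ?thesis using assms by (simp add: linear_continuous_on)
next
  case (Suc m)
  have *: "(L has_derivative L) (at x)" for x
    by (simp add: assms bounded_linear_imp_has_derivative)
  then have "frechet_derivative L (at x) = L" for x
    using frechet_derivative_at by metis
  then show ?thesis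
    using * by (auto simp: Suc differentiable_def higher_differentiable_on_const)
qed

lemma higher_differentiable_on_add:
  assumes "open S" "higher_differentiable_on S f n" "higher_differentiable_on S g n"
  shows "higher_differentiable_on S (\<lambda>x. f x + g x) n"
  using assms(2,3)
proof (induction n arbitrary: f g)
  case 0
  then show ?case by (simp add: continuous_on_add)
next
  case (Suc n)
  show ?case
    by (rule higher_differentiable_on_SucI[OF assms(1) has_derivative_add,
          OF Suc.prems[THEN higher_differentiable_on_has_derivative]])
       (use Suc in auto)
qed

lemma higher_differentiable_on_sum:
  assumes "open S" "\<And>i. i \<in> I \<Longrightarrow> higher_differentiable_on S (f i) n"
  shows "higher_differentiable_on S (\<lambda>x. \<Sum>i\<in>I. f i x) n"
  using assms
  by (induction I rule: infinite_finite_induct)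
     (auto simp: higher_differentiable_on_const intro!: higher_differentiable_on_add)

lemma (in bounded_bilinear) higher_differentiable_on_prod:
  assumes "open S" "higher_differentiable_on S f n" "higher_differentiable_on S g n"
  shows "higher_differentiable_on S (\<lambda>x. prod (f x) (g x)) n"
  using assms(2,3)
proof (induction n arbitrary: f g)
  case 0
  then show ?case by (simp add: continuous_on)
next
  case (Suc n)
  have D: "((\<lambda>x. prod (f x) (g x)) has_derivative (\<lambda>h. prod (f x) (frechet_derivative g (at x) h)
      + prod (frechet_derivative f (at x) h) (g x))) (at x)" if "x \<in> S" for x
    using FDERIV[OF Suc.prems[THEN higher_differentiable_on_has_derivative, OF that]] .
  \<comment> \<open>The product rule leaves one factor undifferentiated; it has to be lowered to
    order \<open>n\<close> before the induction hypothesis applies.\<close>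
  have *: "higher_differentiable_on S f n" "higher_differentiable_on S g n"
    using Suc.prems by (auto intro: higher_differentiable_on_Suc_imp)
  show ?case
  proof (rule higher_differentiable_on_SucI[OF assms(1) D])
    fix v
    show "higher_differentiable_on S (\<lambda>x. prod (f x) (frechet_derivative g (at x) v) +
        prod (frechet_derivative f (at x) v) (g x)) n"
      using Suc.prems *
      by (intro higher_differentiable_on_add assms(1) Suc.IH) simp_all
  qed
qed

lemma (in bounded_linear) higher_differentiable_on_comp:
  assumes "open S" "higher_differentiable_on S g n"
  shows "higher_differentiable_on S (\<lambda>x. f (g x)) n"
  using assms(2)
proof (induction n arbitrary: g)
  case 0
  then show ?case by (simp add: continuous_on)
next
  case (Suc n)
  show ?case
    by (rule higher_differentiable_on_SucI[OF assms(1) has_derivative,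
          OF Suc.prems[THEN higher_differentiable_on_has_derivative]])
       (use Suc.prems Suc.IH in \<open>simp_all\<close>)
qed

section \<open>Families of linear maps depending on a point\<close>

lemma linear_representation_Basis:
  fixes L :: "'e::euclidean_space \<Rightarrow> 'f::real_vector"
  assumes "linear L"
  shows "L u = (\<Sum>b\<in>Basis. (u \<bullet> b) *\<^sub>R L b)"
proof -
  have "L (\<Sum>b\<in>Basis. (u \<bullet> b) *\<^sub>R b) = (\<Sum>b\<in>Basis. (u \<bullet> b) *\<^sub>R L b)"
    using assms by (simp add: linear_sum linear_cmul)
  then show ?thesis by (simp add: euclidean_representation)
qed

text \<open>A family of linear maps is called smooth when its values on fixed vectors are, which
  avoids operator spaces. Expanding \<open>w y\<close> in the basis turns the application into a
  finite sum of products.\<close>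

lemma higher_differentiable_on_apply:
  fixes T :: "'b::real_normed_vector \<Rightarrow> 'e::euclidean_space \<Rightarrow> 'f::real_normed_vector"
  assumes "open S" and lin: "\<And>y. y \<in> S \<Longrightarrow> linear (T y)"
    and T: "\<And>u. u \<in> Basis \<Longrightarrow> higher_differentiable_on S (\<lambda>y. T y u) n"
    and w: "higher_differentiable_on S w n"
  shows "higher_differentiable_on S (\<lambda>y. T y (w y)) n"
proof (rule higher_differentiable_on_cong[OF assms(1)])
  show "higher_differentiable_on S (\<lambda>y. \<Sum>b\<in>Basis. (w y \<bullet> b) *\<^sub>R T y b) n"
    by (intro higher_differentiable_on_sum[OF assms(1)] T
        bounded_bilinear.higher_differentiable_on_prod[OF bounded_bilinear_scaleR assms(1)]
        bounded_linear.higher_differentiable_on_comp[OF bounded_linear_inner_left assms(1)] w)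
  fix y assume "y \<in> S"
  then show "(\<Sum>b\<in>Basis. (w y \<bullet> b) *\<^sub>R T y b) = T y (w y)"
    using linear_representation_Basis[OF lin] by metis
qed

text \<open>By the chain rule the derivative is the linear family \<open>f'(h x)\<close> applied to
  \<open>h'(x) v\<close>. The induction hypothesis, for the derivatives of \<open>f\<close> and the
  same \<open>h\<close>, handles the family, and \<open>higher_differentiable_on_apply\<close> the
  application.\<close>

lemma higher_differentiable_on_compose:
  fixes f :: "'e::euclidean_space \<Rightarrow> 'f::real_normed_vector" and h :: "'b::real_normed_vector \<Rightarrow> 'e"
  assumes "open S" "open R" "h ` S \<subseteq> R"
    "higher_differentiable_on R f n" "higher_differentiable_on S h n"
  shows "higher_differentiable_on S (\<lambda>x. f (h x)) n"
  using assms(4,5)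
proof (induction n arbitrary: f)
  case 0
  then show ?case using assms(3) by (simp add: continuous_on_compose2)
next
  case (Suc n)
  have hR: "h x \<in> R" if "x \<in> S" for x using that assms(3) by auto
  have lin: "linear (frechet_derivative f (at (h x)))" if "x \<in> S" for x
    using Suc.prems(1) hR[OF that]
    by (intro linear_frechet_derivative) simp
  have D: "((\<lambda>x. f (h x)) has_derivative
      (\<lambda>v. frechet_derivative f (at (h x)) (frechet_derivative h (at x) v))) (at x)" if "x \<in> S" for x
    using has_derivative_compose[OF higher_differentiable_on_has_derivative[OF Suc.prems(2) that]
      higher_differentiable_on_has_derivative[OF Suc.prems(1) hR[OF that]]] .
  show ?case
  proof (rule higher_differentiable_on_SucI[OF assms(1) D])
    fix v
    show "higher_differentiable_on S
      (\<lambda>x. frechet_derivative f (at (h x)) (frechet_derivative h (at x) v)) n"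
    proof (rule higher_differentiable_on_apply[OF assms(1) lin])
      show "higher_differentiable_on S (\<lambda>x. frechet_derivative f (at (h x)) u) n" for u
        using Suc.prems(1) by (intro Suc.IH higher_differentiable_on_Suc_imp[OF Suc.prems(2)]) simp
      show "higher_differentiable_on S (\<lambda>x. frechet_derivative h (at x) v) n"
        using Suc.prems(2) by simp
    qed
  qed
qed

text \<open>An injective \<open>T x\<close> satisfies a lower bound with some constant, and half of
  it survives a perturbation whose operator norm is at most the other half.\<close>

lemma linear_family_bounded_below:
  fixes T :: "'b::real_normed_vector \<Rightarrow> 'e::euclidean_space \<Rightarrow> 'f::euclidean_space"
  assumes "open S" "x \<in> S" and lin: "\<And>y. y \<in> S \<Longrightarrow> linear (T y)"
    and cont: "\<And>u. u \<in> Basis \<Longrightarrow> continuous_on S (\<lambda>y. T y u)"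
    and inj: "inj (T x)"
  obtains k where "k > 0" "\<forall>\<^sub>F y in at x. \<forall>u. k * norm u \<le> norm (T y u)"
proof -
  obtain k where k: "k > 0" "\<And>u. k * norm u \<le> norm (T x u)"
    using linear_inj_bounded_below_pos[OF lin[OF assms(2)] inj] by (metis mult.commute)
  have "((\<lambda>y. T y u) \<longlongrightarrow> T x u) (at x)" if "u \<in> Basis" for u
    using cont[OF that] assms(1,2) by (simp add: continuous_on_eq_continuous_at isCont_def)
  \<comment> \<open>This sum over the basis dominates the operator norm of
    \<open>T y - T x\<close>.\<close>
  then have "((\<lambda>y. \<Sum>u\<in>Basis. norm (T y u - T x u)) \<longlongrightarrow> (\<Sum>u\<in>Basis. norm (T x u - T x u))) (at x)"
    by (intro tendsto_intros) auto
  then have "\<forall>\<^sub>F y in at x. (\<Sum>u\<in>Basis. norm (T y u - T x u)) < k / 2"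
    using k(1) by (intro order_tendstoD) auto
  moreover have "\<forall>\<^sub>F y in at x. y \<in> S"
    using assms(1,2) by (rule eventually_at_in_open')
  ultimately have "\<forall>\<^sub>F y in at x. \<forall>u. k / 2 * norm u \<le> norm (T y u)"
  proof eventually_elim
    case (elim y)
    show ?case
    proof
      fix u
      have L: "linear (\<lambda>u. T y u - T x u)"
        using lin elim assms(2) by (simp add: linear_compose_sub)
      have "norm (T y u - T x u) = norm (\<Sum>b\<in>Basis. (u \<bullet> b) *\<^sub>R (T y b - T x b))"
        using linear_representation_Basis[OF L] by metis
      also have "\<dots> \<le> (\<Sum>b\<in>Basis. norm u * norm (T y b - T x b))"
        by (rule sum_norm_le) (simp add: Basis_le_norm mult_right_mono)
      also have "\<dots> = norm u * (\<Sum>b\<in>Basis. norm (T y b - T x b))"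
        by (simp add: sum_distrib_left)
      also have "\<dots> \<le> norm u * (k / 2)"
        using elim by (intro mult_left_mono) auto
      finally have "norm (T y u - T x u) \<le> norm u * (k / 2)" .
      moreover have "norm (T x u) \<le> norm (T y u) + norm (T y u - T x u)"
        by (metis norm_minus_commute norm_triangle_sub)
      ultimately show "k / 2 * norm u \<le> norm (T y u)"
        using k(2)[of u] by (simp add: algebra_simps)
    qed
  qed
  then show ?thesis using that[of "k/2"] k(1) by simp
qed

subsection \<open>Smooth solutions of linear systems\<close>

text \<open>The product is \<open>o(norm (y - x))\<close>: \<open>\<beta> y\<close> is of order
  \<open>norm (y - x)\<close> and \<open>\<alpha>\<close> tends to 0. In the application
  \<open>\<alpha>\<close> is a component of the solution of a linear system, so far only known to be
  continuous.\<close>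

lemma has_derivative_scaleR_zero_at:
  fixes \<beta> :: "'b::real_normed_vector \<Rightarrow> 'c::real_normed_vector"
  assumes \<alpha>: "(\<alpha> \<longlongrightarrow> 0) (at x)" and \<beta>: "(\<beta> has_derivative \<beta>') (at x)" "\<beta> x = 0"
  shows "((\<lambda>y. \<alpha> y *\<^sub>R \<beta> y) has_derivative (\<lambda>h. 0)) (at x)"
proof -
  let ?q = "\<lambda>y. norm (\<beta> y - \<beta> x - \<beta>' (y - x)) / norm (y - x)"
  obtain K where K: "\<And>h. norm (\<beta>' h) \<le> norm h * K"
    using bounded_linear.bounded[OF has_derivative_bounded_linear[OF \<beta>(1)]] by blast
  have q: "(?q \<longlongrightarrow> 0) (at x)"
    using \<beta>(1) by (simp add: has_derivative_iff_norm)
  have "((\<lambda>y. \<bar>\<alpha> y\<bar> * (K + ?q y)) \<longlongrightarrow> \<bar>0\<bar> * (K + 0)) (at x)"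
    by (intro tendsto_intros \<alpha> q)
  then have lim: "((\<lambda>y. \<bar>\<alpha> y\<bar> * (K + ?q y)) \<longlongrightarrow> 0) (at x)"
    by simp
  have "norm (\<alpha> y *\<^sub>R \<beta> y - \<alpha> x *\<^sub>R \<beta> x - 0) / norm (y - x) \<le> \<bar>\<alpha> y\<bar> * (K + ?q y)" if "y \<noteq> x" for y
  proof -
    have "norm (\<beta> y) \<le> norm (\<beta>' (y - x)) + norm (\<beta> y - \<beta> x - \<beta>' (y - x))"
      using norm_triangle_sub[of "\<beta> y" "\<beta>' (y - x)"] \<beta>(2) by simp
    also have "\<dots> \<le> norm (y - x) * (K + ?q y)"
      using K[of "y - x"] that by (simp add: algebra_simps)
    finally have "norm (\<beta> y) / norm (y - x) \<le> K + ?q y"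
      using that by (simp add: divide_le_eq mult.commute)
    then show ?thesis
      using mult_left_mono[of "norm (\<beta> y) / norm (y - x)" _ "\<bar>\<alpha> y\<bar>"] \<beta>(2) by simp
  qed
  then have "((\<lambda>y. norm (\<alpha> y *\<^sub>R \<beta> y - \<alpha> x *\<^sub>R \<beta> x - 0) / norm (y - x)) \<longlongrightarrow> 0) (at x)"
    by (intro tendsto_sandwich[OF _ _ tendsto_const lim])
       (auto simp: eventually_at_filter)
  then show ?thesis
    by (simp add: has_derivative_iff_norm)
qed

text \<open>The residual \<open>r y = T y (w y - w x)\<close> is continuous and vanishes at
  \<open>x\<close>, and \<open>T y\<close> is bounded below uniformly near \<open>x\<close>, so
  \<open>w y - w x\<close> is squeezed to 0.\<close>

lemma tendsto_linear_solve:
  fixes T :: "'b::real_normed_vector \<Rightarrow> 'e::euclidean_space \<Rightarrow> 'e"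
  assumes S: "open S" "x \<in> S" and lin: "\<And>y. y \<in> S \<Longrightarrow> linear (T y)" and inj: "inj (T x)"
    and cont: "\<And>u. u \<in> Basis \<Longrightarrow> continuous_on S (\<lambda>y. T y u)"
    and z: "isCont z x"
    and w: "\<And>y. y \<in> S \<Longrightarrow> T y (w y) = z y"
  shows "(w \<longlongrightarrow> w x) (at x)"
proof -
  define r where "r y = z y - (\<Sum>b\<in>Basis. (w x \<bullet> b) *\<^sub>R T y b)" for y
  have r: "r y = T y (w y - w x)" if "y \<in> S" for y
    using w[OF that] linear_representation_Basis[OF lin[OF that], of "w x"]
      linear_diff[OF lin[OF that], of "w y" "w x"]
    by (simp add: r_def)
  have r0: "r x = 0" using r[OF S(2)] lin[OF S(2)] by (simp add: linear_0)
  have "isCont (\<lambda>y. T y b) x" if "b \<in> Basis" for b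
    using cont[OF that] S by (simp add: continuous_on_eq_continuous_at)
  then have "isCont r x"
    unfolding r_def by (intro continuous_intros z)
  then have "(r \<longlongrightarrow> 0) (at x)"
    using r0 by (simp add: isCont_def)
  obtain k where k: "k > 0" "\<forall>\<^sub>F y in at x. \<forall>u. k * norm u \<le> norm (T y u)"
    using linear_family_bounded_below[where T = T, OF S lin cont inj] by blast
  have "\<forall>\<^sub>F y in at x. y \<in> S" using S by (rule eventually_at_in_open')
  with k(2) have bound: "\<forall>\<^sub>F y in at x. norm (w y - w x) \<le> norm (r y) / k"
  proof eventually_elim
    case (elim y)
    then show ?case using k(1) r[of y] by (simp add: pos_le_divide_eq mult.commute)
  qed
  have "((\<lambda>y. norm (r y) / k) \<longlongrightarrow> 0) (at x)"
    using tendsto_divide[OF tendsto_norm[OF \<open>(r \<longlongrightarrow> 0) (at x)\<close>] tendsto_const, of k] k(1) by simp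
  then have "((\<lambda>y. w y - w x) \<longlongrightarrow> 0) (at x)"
    by (rule Lim_null_comparison[OF bound])
  then show ?thesis
    by (simp add: LIM_zero_iff)
qed

text \<open>The derivative is what formal differentiation of \<open>T y (w y) = z y\<close>
  predicts: \<open>T x (w' h) = z' h - T'(h) (w x)\<close>.\<close>

lemma has_derivative_linear_solve:
  fixes T :: "'b::real_normed_vector \<Rightarrow> 'e::euclidean_space \<Rightarrow> 'e"
  assumes S: "open S" "x \<in> S" and lin: "\<And>y. y \<in> S \<Longrightarrow> linear (T y)" and inj: "inj (T x)"
    and cont: "\<And>u. u \<in> Basis \<Longrightarrow> continuous_on S (\<lambda>y. T y u)"
    and T': "\<And>u. u \<in> Basis \<Longrightarrow> ((\<lambda>y. T y u) has_derivative T' u) (at x)"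
    and z': "(z has_derivative z') (at x)"
    and w: "\<And>y. y \<in> S \<Longrightarrow> T y (w y) = z y"
  shows "(w has_derivative (\<lambda>h. inv (T x) (z' h - (\<Sum>b\<in>Basis. (w x \<bullet> b) *\<^sub>R T' b h)))) (at x)"
proof -
  let ?R = "inv (T x)"
  have Tx: "linear (T x)" by (rule lin[OF S(2)])
  have R: "?R (T x u) = u" for u using inj by simp
  have linR: "linear ?R"
    by (rule inj_linear_imp_inv_linear[OF Tx inj])
  then have bR: "bounded_linear ?R" by (simp add: linear_conv_bounded_linear)
  define r where "r y = z y - (\<Sum>b\<in>Basis. (w x \<bullet> b) *\<^sub>R T y b)" for y
  have r': "(r has_derivative (\<lambda>h. z' h - (\<Sum>b\<in>Basis. (w x \<bullet> b) *\<^sub>R T' b h))) (at x)"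
    unfolding r_def by (intro derivative_intros z' T')
  have r: "r y = T y (w y - w x)" if "y \<in> S" for y
    using w[OF that] linear_representation_Basis[OF lin[OF that], of "w x"]
      linear_diff[OF lin[OF that], of "w y" "w x"]
    by (simp add: r_def)
  have r0: "r x = 0" using r[OF S(2)] Tx by (simp add: linear_0)
  \<comment> \<open>An exact identity rather than an estimate: applying \<open>?R\<close> to
    \<open>T x (w y - w x) = r y - (T y - T x) (w y - w x)\<close>. Both factors of the last term
    vanish at \<open>x\<close>, so it contributes nothing to the derivative.\<close>
  have w_eq: "w y = w x + ?R (r y) - (\<Sum>b\<in>Basis. ((w y - w x) \<bullet> b) *\<^sub>R ?R (T y b - T x b))"
    if y: "y \<in> S" for y
  proof -
    have "T y (w y - w x) - T x (w y - w x) = (\<Sum>b\<in>Basis. ((w y - w x) \<bullet> b) *\<^sub>R (T y b - T x b))"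
      by (rule linear_representation_Basis) (intro linear_compose_sub lin y S(2))
    then have "T x (w y - w x) = r y - (\<Sum>b\<in>Basis. ((w y - w x) \<bullet> b) *\<^sub>R (T y b - T x b))"
      unfolding r[OF y] by (metis diff_diff_eq2 add_diff_cancel_left' add.commute)
    then have "w y - w x = ?R (r y - (\<Sum>b\<in>Basis. ((w y - w x) \<bullet> b) *\<^sub>R (T y b - T x b)))"
      by (metis R)
    also have "\<dots> = ?R (r y) - (\<Sum>b\<in>Basis. ((w y - w x) \<bullet> b) *\<^sub>R ?R (T y b - T x b))"
      by (simp add: linear_diff[OF linR] linear_sum[OF linR] linear_cmul[OF linR])
    finally show ?thesis by (simp add: algebra_simps)
  qed
  have "(w \<longlongrightarrow> w x) (at x)"
    by (rule tendsto_linear_solve[where T = T, OF S lin inj cont has_derivative_continuous[OF z'] w])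
  then have "((\<lambda>y. w y - w x) \<longlongrightarrow> 0) (at x)"
    by (rule LIM_zero)
  then have w0: "((\<lambda>y. (w y - w x) \<bullet> b) \<longlongrightarrow> 0) (at x)" for b
    using tendsto_inner[OF _ tendsto_const, of _ 0 "at x" b] by simp
  have T0: "((\<lambda>y. ?R (T y b - T x b)) has_derivative (\<lambda>h. ?R (T' b h - 0))) (at x)" if "b \<in> Basis" for b
    by (intro bounded_linear.has_derivative[OF bR] derivative_intros T' that)
  have "((\<lambda>y. w x + ?R (r y) - (\<Sum>b\<in>Basis. ((w y - w x) \<bullet> b) *\<^sub>R ?R (T y b - T x b))) has_derivative
     (\<lambda>h. 0 + ?R (z' h - (\<Sum>b\<in>Basis. (w x \<bullet> b) *\<^sub>R T' b h)) - (\<Sum>b\<in>(Basis::'e set). 0))) (at x)"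
    by (intro has_derivative_diff has_derivative_add has_derivative_const has_derivative_sum
        bounded_linear.has_derivative[OF bR] r' has_derivative_scaleR_zero_at[OF w0 T0])
       (simp_all add: linear_0[OF linR])
  then have "((\<lambda>y. w x + ?R (r y) - (\<Sum>b\<in>Basis. ((w y - w x) \<bullet> b) *\<^sub>R ?R (T y b - T x b))) has_derivative
     (\<lambda>h. ?R (z' h - (\<Sum>b\<in>Basis. (w x \<bullet> b) *\<^sub>R T' b h)))) (at x)"
    by simp
  then show ?thesis
    by (rule has_derivative_transform_within_open[OF _ S]) (metis w_eq)
qed

text \<open>Replaces determinants and smoothness of operator inversion: the derivative of the
  solution solves a system with the same \<open>T\<close> and a new right-hand side, hence the
  induction with \<open>T\<close> fixed and \<open>z\<close> arbitrary.\<close>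

lemma higher_differentiable_on_linear_solve:
  fixes T :: "'b::real_normed_vector \<Rightarrow> 'e::euclidean_space \<Rightarrow> 'e"
  assumes "open S" and lin: "\<And>y. y \<in> S \<Longrightarrow> linear (T y)" and inj: "\<And>y. y \<in> S \<Longrightarrow> inj (T y)"
    and T: "\<And>u. u \<in> Basis \<Longrightarrow> higher_differentiable_on S (\<lambda>y. T y u) n"
    and z: "higher_differentiable_on S z n"
  shows "higher_differentiable_on S (\<lambda>y. inv (T y) (z y)) n"
proof -
  have sol: "T y (inv (T y) v) = v" if "y \<in> S" for y v
    using that lin inj by (simp add: surj_f_inv_f linear_inj_imp_surj)
  show ?thesis using T z
  proof (induction n arbitrary: z)
    case 0
    have "continuous (at x) (\<lambda>y. inv (T y) (z y))" if "x \<in> S" for x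
      unfolding isCont_def
      by (rule tendsto_linear_solve[where T = T and z = z, OF assms(1) that lin inj[OF that]])
         (use 0 sol that assms(1) in \<open>auto simp: continuous_on_eq_continuous_at\<close>)
    then show ?case
      by (simp add: continuous_at_imp_continuous_on)
  next
    case (Suc n)
    let ?w = "\<lambda>y. inv (T y) (z y)"
    let ?z' = "\<lambda>v x. frechet_derivative z (at x) v
      - (\<Sum>b\<in>Basis. (?w x \<bullet> b) *\<^sub>R frechet_derivative (\<lambda>y. T y b) (at x) v)"
    have T': "higher_differentiable_on S (\<lambda>y. T y b) n" if "b \<in> Basis" for b
      using Suc.prems(1)[OF that] by (rule higher_differentiable_on_Suc_imp)
    have cont: "continuous_on S (\<lambda>y. T y b)" if "b \<in> Basis" for b
      using higher_differentiable_on_has_derivative[OF Suc.prems(1)[OF that]]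
      by (meson has_derivative_continuous continuous_at_imp_continuous_on)
    \<comment> \<open>The right-hand side of the differentiated system contains the solution
      \<open>?w\<close> itself. The induction hypothesis is therefore used twice: here to obtain
      \<open>?w\<close> at order \<open>n\<close>, and below for the new system.\<close>
    have w: "higher_differentiable_on S ?w n"
      using Suc.IH[OF T' higher_differentiable_on_Suc_imp[OF Suc.prems(2)]] .
    have z': "higher_differentiable_on S (?z' v) n" for v
      unfolding diff_conv_add_uminus sum_negf[symmetric] scaleR_minus_left[symmetric]
      by (intro higher_differentiable_on_add higher_differentiable_on_sum assms(1)
          bounded_bilinear.higher_differentiable_on_prod[OF bounded_bilinear_scaleR]
          bounded_linear.higher_differentiable_on_comp[OF bounded_linear_minus[OF bounded_linear_inner_left]] w)
        (use Suc.prems in simp_all)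
    show ?case
    proof (rule higher_differentiable_on_SucI[OF assms(1)])
      show "(?w has_derivative (\<lambda>v. inv (T x) (?z' v x))) (at x)" if "x \<in> S" for x
        by (rule has_derivative_linear_solve[where T = T, OF assms(1) that lin inj[OF that] cont
              higher_differentiable_on_has_derivative[OF Suc.prems(1) that]
              higher_differentiable_on_has_derivative[OF Suc.prems(2) that] sol])
      show "higher_differentiable_on S (\<lambda>x. inv (T x) (?z' v x)) n" for v
        by (rule Suc.IH[OF T' z'])
    qed
  qed
qed

subsection \<open>Smooth maps\<close>

lemma smooth_on_imp_higher_differentiable_on:
  "smooth_on S f \<Longrightarrow> higher_differentiable_on S f n"
  by (simp add: smooth_on_def)

lemma smooth_on_imp_continuous_on: "smooth_on S f \<Longrightarrow> continuous_on S f"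
  unfolding smooth_on_def by (metis higher_differentiable_on.simps(1))

lemma smooth_on_subset: "smooth_on S f \<Longrightarrow> R \<subseteq> S \<Longrightarrow> smooth_on R f"
  unfolding smooth_on_def by (meson higher_differentiable_on_subset)

lemma smooth_on_cong:
  "open S \<Longrightarrow> (\<And>y. y \<in> S \<Longrightarrow> f y = g y) \<Longrightarrow> smooth_on S f \<Longrightarrow> smooth_on S g"
  unfolding smooth_on_def using higher_differentiable_on_cong[of S f g] by blast

lemma smooth_on_const: "smooth_on S (\<lambda>x. c)"
  by (simp add: smooth_on_def higher_differentiable_on_const)

lemma smooth_on_bounded_linear: "bounded_linear L \<Longrightarrow> smooth_on S L"
  by (simp add: smooth_on_def higher_differentiable_on_linear)

lemma smooth_on_add:
  "open S \<Longrightarrow> smooth_on S f \<Longrightarrow> smooth_on S g \<Longrightarrow> smooth_on S (\<lambda>x. f x + g x)"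
  by (simp add: smooth_on_def higher_differentiable_on_add)

lemma smooth_on_sum:
  "open S \<Longrightarrow> (\<And>i. i \<in> I \<Longrightarrow> smooth_on S (f i)) \<Longrightarrow> smooth_on S (\<lambda>x. \<Sum>i\<in>I. f i x)"
  by (simp add: smooth_on_def higher_differentiable_on_sum)

lemma smooth_on_scaleR:
  "open S \<Longrightarrow> smooth_on S f \<Longrightarrow> smooth_on S g \<Longrightarrow> smooth_on S (\<lambda>x. f x *\<^sub>R g x)"
  by (simp add: smooth_on_def
      bounded_bilinear.higher_differentiable_on_prod[OF bounded_bilinear_scaleR])

lemma smooth_on_bounded_linear_comp:
  "bounded_linear L \<Longrightarrow> open S \<Longrightarrow> smooth_on S f \<Longrightarrow> smooth_on S (\<lambda>x. L (f x))"
  by (simp add: smooth_on_def bounded_linear.higher_differentiable_on_comp)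

lemma smooth_on_apply:
  fixes T :: "'b::real_normed_vector \<Rightarrow> 'e::euclidean_space \<Rightarrow> 'f::real_normed_vector"
  assumes "open S" "\<And>y. y \<in> S \<Longrightarrow> linear (T y)" "\<And>u. smooth_on S (\<lambda>y. T y u)" "smooth_on S w"
  shows "smooth_on S (\<lambda>y. T y (w y))"
  using assms by (simp add: smooth_on_def higher_differentiable_on_apply)

lemma smooth_on_compose:
  fixes f :: "'e::euclidean_space \<Rightarrow> 'f::real_normed_vector" and h :: "'b::real_normed_vector \<Rightarrow> 'e"
  assumes "open S" "open R" "h ` S \<subseteq> R" "smooth_on R f" "smooth_on S h"
  shows "smooth_on S (\<lambda>x. f (h x))"
  unfolding smooth_on_def
  using assms(4,5)[THEN smooth_on_imp_higher_differentiable_on]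
  by (rule allI[OF higher_differentiable_on_compose[OF assms(1-3)]])

lemma smooth_on_linear_solve:
  fixes T :: "'b::real_normed_vector \<Rightarrow> 'e::euclidean_space \<Rightarrow> 'e"
  assumes "open S" "\<And>y. y \<in> S \<Longrightarrow> linear (T y)" "\<And>y. y \<in> S \<Longrightarrow> inj (T y)"
    "\<And>u. smooth_on S (\<lambda>y. T y u)" "smooth_on S z"
  shows "smooth_on S (\<lambda>y. inv (T y) (z y))"
  using assms by (simp add: smooth_on_def higher_differentiable_on_linear_solve)

lemma smooth_on_frechet_derivative:
  "smooth_on S f \<Longrightarrow> smooth_on S (\<lambda>x. frechet_derivative f (at x) v)"
  unfolding smooth_on_def using higher_differentiable_on.simps(2) by blast

lemma smooth_on_has_derivative:
  "smooth_on S f \<Longrightarrow> x \<in> S \<Longrightarrow> (f has_derivative frechet_derivative f (at x)) (at x)"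
  unfolding smooth_on_def using higher_differentiable_on_has_derivative by blast

subsection \<open>A complex structure transversal to an endomorphism\<close>

text \<open>The rows \<open>(x, y)\<close> and \<open>(z, -x)\<close> describe the real 2x2 matrices
  with square -1, and the second expression is the determinant of the block
  \<open>p, q, r, s\<close> plus such a matrix. If it vanished for all of them, four test matrices
  would make the block \<open>p\<close> times the identity with
  \<open>p * p + 1 = 0\<close>.\<close>

lemma ex_complex_structure_2x2:
  fixes p q r s :: real
  shows "\<exists>x y z. x * x + y * z = -1 \<and> (p + x) * (s - x) - (q + y) * (r + z) \<noteq> 0"
proof (rule ccontr)
  assume "\<not> ?thesis"
  then have *: "x * x + y * z = -1 \<Longrightarrow> (p + x) * (s - x) - (q + y) * (r + z) = 0" for x y z
    by blast
  have "r = q" "p * s - q * r + 1 = 0"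
    using *[of 0 "-1" 1] *[of 0 1 "-1"] by (simp_all add: algebra_simps)
  moreover from this have "q = 0"
    using *[of 0 "-2" "1/2"] by (simp add: field_simps)
  moreover from calculation have "s = p"
    using *[of 1 "-2" 1] by (simp add: algebra_simps)
  ultimately have "p * p + 1 = 0" by simp
  then show False using zero_le_square[of p] by linarith
qed

text \<open>The induction splits off the plane of two basis vectors \<open>e, f\<close>. For \<open>w\<close> in the complement,
  \<open>\<alpha> w\<close> and \<open>\<beta> w\<close> are the coefficients making the \<open>e\<close>- and \<open>f\<close>-components of \<open>(A + J) (\<alpha> w e + \<beta> w f + w)\<close>
  vanish, and the induction hypothesis is applied to the resulting Schur complement \<open>A'\<close>.\<close>

lemma ex_complex_structure_subset_Basis:
  fixes A :: "'e::euclidean_space \<Rightarrow> 'e"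
  assumes "B \<subseteq> Basis" "card B = 2 * n" "linear A"
  shows "\<exists>J. linear J \<and> (\<forall>u. (\<forall>b\<in>Basis - B. u \<bullet> b = 0) \<longrightarrow>
     (\<forall>b\<in>Basis - B. J u \<bullet> b = 0) \<and> J (J u) = - u \<and> ((\<forall>b\<in>B. (A u + J u) \<bullet> b = 0) \<longrightarrow> u = 0))"
  using assms
\<comment> \<open>The coordinate subspace spanned by \<open>B\<close> plays the role of a space of
  smaller dimension, so the induction stays inside the type \<open>'e\<close>. \<open>A\<close>
  varies because each step replaces it by a Schur complement.\<close>
proof (induction n arbitrary: B A)
  case 0
  then have "finite B" using finite_subset finite_Basis by blast
  with 0 have "B = {}" by simp
  then show ?case
    by (intro exI[of _ "\<lambda>u. 0"]) (auto simp: linear_zero intro: euclidean_eqI)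
next
  case (Suc n)
  note linA = Suc.prems(3)
  have "finite B" using Suc.prems(1) finite_subset finite_Basis by blast
  obtain e where e: "e \<in> B" using Suc.prems(2) by fastforce
  with Suc.prems(2) \<open>finite B\<close> have "card (B - {e}) = Suc (2 * n)" by simp
  then have "B - {e} \<noteq> {}" by force
  then obtain f where f: "f \<in> B - {e}" by blast
  define C where "C = B - {e} - {f}"
  have C: "C \<subseteq> Basis" "card C = 2 * n" "e \<notin> C" "f \<notin> C" "B = insert e (insert f C)"
    using Suc.prems(1) e f \<open>card (B - {e}) = Suc (2 * n)\<close> \<open>finite B\<close> by (auto simp: C_def)
  have ef: "e \<in> Basis" "f \<in> Basis" "e \<noteq> f" using Suc.prems(1) e f by auto
  then have [simp]: "e \<bullet> e = 1" "f \<bullet> f = 1" "e \<bullet> f = 0" "f \<bullet> e = 0"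
    by (auto simp: inner_not_same_Basis)
  have efC: "e \<bullet> b = 0" "f \<bullet> b = 0" if "b \<in> Basis" "b \<noteq> e" "b \<noteq> f" for b
    using that ef by (auto simp: inner_not_same_Basis)
  define p q r s where pqrs: "p = A e \<bullet> e" "q = A f \<bullet> e" "r = A e \<bullet> f" "s = A f \<bullet> f"
  obtain x y z where xyz: "x * x + y * z = -1" and det: "(p + x) * (s - x) - (q + y) * (r + z) \<noteq> 0"
    using ex_complex_structure_2x2 by blast
  define \<delta> where "\<delta> = (p + x) * (s - x) - (q + y) * (r + z)"
  have "\<delta> \<noteq> 0" using det by (simp add: \<delta>_def)
  \<comment> \<open>Cramer's rule for the 2x2 system \<open>E\<close>, \<open>F\<close> below, with
    determinant \<open>\<delta>\<close>.\<close>
  define \<alpha> where "\<alpha> w = inverse \<delta> * ((q + y) * (A w \<bullet> f) - (s - x) * (A w \<bullet> e))" for w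
  define \<beta> where "\<beta> w = inverse \<delta> * ((r + z) * (A w \<bullet> e) - (p + x) * (A w \<bullet> f))" for w
  define A' where "A' w = A (\<alpha> w *\<^sub>R e + \<beta> w *\<^sub>R f + w)" for w
  have lin\<alpha>: "linear \<alpha>" "linear \<beta>"
    unfolding \<alpha>_def \<beta>_def using linA
    by (auto intro!: linearI simp: linear_add linear_cmul inner_add_left algebra_simps)
  have "linear A'"
    using lin\<alpha> linA unfolding A'_def
    by (auto intro!: linearI simp: linear_add linear_cmul algebra_simps)
  from Suc.IH[OF C(1,2) this] obtain J' where linJ': "linear J'" and *:
    "\<forall>u. (\<forall>b\<in>Basis - C. u \<bullet> b = 0) \<longrightarrow> (\<forall>b\<in>Basis - C. J' u \<bullet> b = 0) \<and> J' (J' u) = - u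
      \<and> ((\<forall>b\<in>C. (A' u + J' u) \<bullet> b = 0) \<longrightarrow> u = 0)"
    by blast
  have J': "b \<in> Basis - C \<Longrightarrow> J' u \<bullet> b = 0" "J' (J' u) = - u"
    "\<forall>b\<in>C. (A' u + J' u) \<bullet> b = 0 \<Longrightarrow> u = 0" if "\<forall>b\<in>Basis - C. u \<bullet> b = 0" for u b
    using *[rule_format, of u] that by simp_all
  define \<pi> where "\<pi> u = u - (u \<bullet> e) *\<^sub>R e - (u \<bullet> f) *\<^sub>R f" for u
  define J where "J u = (x * (u \<bullet> e) + y * (u \<bullet> f)) *\<^sub>R e + (z * (u \<bullet> e) - x * (u \<bullet> f)) *\<^sub>R f + J' (\<pi> u)" for u
  have lin\<pi>: "linear \<pi>"
    by (auto intro!: linearI simp: \<pi>_def algebra_simps)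
  have linJ: "linear J"
    using lin\<pi> linJ' unfolding J_def
    by (auto intro!: linearI simp: linear_add linear_cmul algebra_simps)
  have \<pi>C: "\<forall>b\<in>Basis - C. \<pi> u \<bullet> b = 0" if "\<forall>b\<in>Basis - B. u \<bullet> b = 0" for u
  proof
    fix b assume b: "b \<in> Basis - C"
    consider "b = e" | "b = f" | "b \<in> Basis - B" "b \<noteq> e" "b \<noteq> f" using b C(5) by auto
    then show "\<pi> u \<bullet> b = 0"
      by cases (use that efC in \<open>simp_all add: \<pi>_def inner_diff_left\<close>)
  qed
  have Je: "J u \<bullet> e = x * (u \<bullet> e) + y * (u \<bullet> f)" and Jf: "J u \<bullet> f = z * (u \<bullet> e) - x * (u \<bullet> f)"
    if "\<forall>b\<in>Basis - B. u \<bullet> b = 0" for u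
    using J'(1)[OF \<pi>C[OF that]] ef C by (auto simp: J_def inner_add_left)
  have Jb: "J u \<bullet> b = J' (\<pi> u) \<bullet> b" if "b \<in> Basis" "b \<noteq> e" "b \<noteq> f" for u b
    using efC[OF that] by (simp add: J_def inner_add_left)
  show ?case
  proof (intro exI[of _ J] conjI allI impI linJ)
    fix u assume u: "\<forall>b\<in>Basis - B. u \<bullet> b = 0"
    show Ju: "\<forall>b\<in>Basis - B. J u \<bullet> b = 0"
      using J'(1)[OF \<pi>C[OF u]] Jb C(5) by auto
    have "\<pi> (J u) = J' (\<pi> u)"
      by (simp add: \<pi>_def Je[OF u] Jf[OF u]) (simp add: J_def \<pi>_def)
    then have "J (J u) = ((x * x + y * z) * (u \<bullet> e)) *\<^sub>R e + ((x * x + y * z) * (u \<bullet> f)) *\<^sub>R f - \<pi> u"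
      using J'(2)[OF \<pi>C[OF u]] by (simp add: J_def[of "J u"] Je[OF u] Jf[OF u] algebra_simps)
    then show "J (J u) = - u"
      by (simp add: xyz \<pi>_def)
    assume 0: "\<forall>b\<in>B. (A u + J u) \<bullet> b = 0"
    define a b w where abw: "a = u \<bullet> e" "b = u \<bullet> f" "w = \<pi> u"
    have u_eq: "u = a *\<^sub>R e + b *\<^sub>R f + w" by (simp add: abw \<pi>_def)
    have Au: "A u = a *\<^sub>R A e + b *\<^sub>R A f + A w"
      by (simp add: u_eq linear_add[OF linA] linear_cmul[OF linA])
    have E: "(p + x) * a + (q + y) * b = - (A w \<bullet> e)"
      using 0 C(5) Je[OF u] by (simp add: inner_add_left Au pqrs flip: abw) (simp add: algebra_simps)
    have F: "(r + z) * a + (s - x) * b = - (A w \<bullet> f)"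
      using 0 C(5) Jf[OF u] by (simp add: inner_add_left Au pqrs flip: abw) (simp add: algebra_simps)
    have "\<delta> * a = (s - x) * ((p + x) * a + (q + y) * b) - (q + y) * ((r + z) * a + (s - x) * b)"
      by (simp add: \<delta>_def algebra_simps)
    then have a: "a = \<alpha> w"
      using \<open>\<delta> \<noteq> 0\<close> unfolding E F by (simp add: \<alpha>_def field_simps)
    have "\<delta> * b = (p + x) * ((r + z) * a + (s - x) * b) - (r + z) * ((p + x) * a + (q + y) * b)"
      by (simp add: \<delta>_def algebra_simps)
    then have b: "b = \<beta> w"
      using \<open>\<delta> \<noteq> 0\<close> unfolding E F by (simp add: \<beta>_def field_simps)
    \<comment> \<open>Once the coefficients of \<open>e\<close> and \<open>f\<close> are expressed
      by \<open>w\<close>, the remaining equations are those of the induction hypothesis for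
      \<open>A'\<close>, which forces \<open>w = 0\<close> and with it both coefficients.\<close>
    have "A' w = A u" using u_eq a b by (simp add: A'_def)
    moreover have "J u \<bullet> b = J' w \<bullet> b" if "b \<in> C" for b
      using Jb[of b u] that C by (auto simp: abw)
    ultimately have "\<forall>b\<in>C. (A' w + J' w) \<bullet> b = 0"
      using 0 C(5) by (simp add: inner_add_left)
    then have "w = 0" using J'(3) \<pi>C[OF u] by (simp add: abw)
    then have "a = 0" "b = 0"
      using a b lin\<alpha> by (auto simp: linear_0)
    then show "u = 0" using u_eq \<open>w = 0\<close> by simp
  qed
qed

text \<open>The induction applied to the whole of \<open>Basis\<close>; here the parity of the
  dimension enters.\<close>

lemma ex_complex_structure_transversal:
  fixes A :: "'e::euclidean_space \<Rightarrow> 'e"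
  assumes "even DIM('e)" "linear A"
  obtains J where "linear J" "\<And>u. J (J u) = - u" "inj (\<lambda>u. A u + J u)"
proof -
  obtain n where "card (Basis :: 'e set) = 2 * n" using assms(1) by (elim evenE)
  from ex_complex_structure_subset_Basis[OF order_refl this assms(2)] obtain J where
    J: "linear J" "\<And>u. J (J u) = - u" "\<And>u. (\<forall>b\<in>Basis. (A u + J u) \<bullet> b = 0) \<longrightarrow> u = 0"
    by auto
  have "linear (\<lambda>u. A u + J u)" by (intro linear_compose_add assms J)
  then have "inj (\<lambda>u. A u + J u)"
    by (rule linear_injective_0[THEN iffD2]) (use J(3) in auto)
  then show ?thesis using that J by blast
qed

subsection \<open>A complex structure near a point\<close>

text \<open>Raises an index with the standard inner product of the coordinate space, not with
  \<open>g\<close>. \<open>sharp\<close> of a form is the matrix that the overview calls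
  \<open>G\<close> or \<open>W\<close>.\<close>

definition sharp :: "('e::euclidean_space \<Rightarrow> 'e \<Rightarrow> real) \<Rightarrow> 'e \<Rightarrow> 'e" where
  "sharp B u = (\<Sum>b\<in>Basis. B u b *\<^sub>R b)"

lemma linear_sharp: "bilinear B \<Longrightarrow> linear (sharp B)"
  by (auto intro!: linearI simp: sharp_def bilinear_ladd bilinear_lmul scaleR_sum_right
      scaleR_add_left sum.distrib)

lemma sharp_inner:
  assumes "bilinear B"
  shows "sharp B u \<bullet> v = B u v"
proof -
  have "B u v = (\<Sum>b\<in>Basis. (v \<bullet> b) *\<^sub>R B u b)"
    using assms by (intro linear_representation_Basis) (simp add: bilinear_def)
  then show ?thesis
    by (simp add: sharp_def inner_sum_left inner_commute[of v] mult.commute)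
qed

lemma sharp_eqI:
  assumes "\<And>w. B u w = C v w"
  shows "sharp B u = sharp C v"
  by (simp add: sharp_def assms)

lemma inj_sharp:
  assumes "bilinear B" "\<And>u. u \<noteq> 0 \<Longrightarrow> B u u > 0"
  shows "inj (sharp B)"
proof (rule linear_injective_0[OF linear_sharp[OF assms(1)], THEN iffD2], intro allI impI)
  fix u assume "sharp B u = 0"
  then have "B u u = 0" using sharp_inner[OF assms(1), of u u] by simp
  then show "u = 0" using assms(2)[of u] by fastforce
qed

lemma smooth_on_sharp:
  assumes "open S" "\<And>u v. smooth_on S (\<lambda>y. B y u v)"
  shows "smooth_on S (\<lambda>y. sharp (B y) u)"
  unfolding sharp_def by (intro smooth_on_sum smooth_on_scaleR smooth_on_const assms)

lemma smooth_on_bilinear_apply: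
  fixes B :: "'b::real_normed_vector \<Rightarrow> 'e::euclidean_space \<Rightarrow> 'e \<Rightarrow> real"
  assumes "open S" "\<And>y. y \<in> S \<Longrightarrow> bilinear (B y)" "\<And>u v. smooth_on S (\<lambda>y. B y u v)"
    "smooth_on S f" "smooth_on S h"
  shows "smooth_on S (\<lambda>y. B y (f y) (h y))"
  by (rule smooth_on_apply[where T = "\<lambda>y. B y (f y)"], fact,
      use assms(2) in \<open>simp add: bilinear_def\<close>,
      rule smooth_on_apply[where T = "\<lambda>y u. B y u v" for v], fact,
      use assms in \<open>simp_all add: bilinear_def\<close>)

lemma ex_local_complex_structure:
  fixes G W :: "'e::euclidean_space \<Rightarrow> 'e \<Rightarrow> 'e \<Rightarrow> real"
  assumes "even DIM('e)" and V: "open V" "y0 \<in> V"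
    and G: "\<And>y. y \<in> V \<Longrightarrow> bilinear (G y)" "\<And>u v. smooth_on V (\<lambda>y. G y u v)"
    and G_pos: "\<And>y u. y \<in> V \<Longrightarrow> u \<noteq> 0 \<Longrightarrow> G y u u > 0"
    and W: "\<And>y. y \<in> V \<Longrightarrow> bilinear (W y)" "\<And>u v. smooth_on V (\<lambda>y. W y u v)"
  obtains V' J where "open V'" "y0 \<in> V'" "V' \<subseteq> V"
    "\<And>y. y \<in> V' \<Longrightarrow> linear (J y)" "\<And>y u. y \<in> V' \<Longrightarrow> J y (J y u) = - u"
    "\<And>u. smooth_on V' (\<lambda>y. J y u)"
    "\<And>y u v. y \<in> V' \<Longrightarrow> (\<And>w. W y u w = G y v w) \<Longrightarrow> (\<And>w. W y v w = - G y u w) \<Longrightarrow> J y u = v"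
proof -
  define R where "R = inv (sharp (G y0))"
  have inj: "inj (sharp (G y0))"
    by (rule inj_sharp[OF G(1)]) (use V G_pos in auto)
  have linG: "linear (sharp (G y))" and linW: "linear (sharp (W y))" if "y \<in> V" for y
    using linear_sharp G(1) W(1) that by blast+
  have linR: "linear R"
    unfolding R_def by (rule inj_linear_imp_inv_linear[OF linG[OF V(2)] inj])
  have R: "R (sharp (G y0) u) = u" for u
    using inj by (simp add: R_def)
  \<comment> \<open>\<open>R\<close> is the inverse of \<open>G\<close> at \<open>y0\<close>, and
    \<open>T y0 = (W R + J0) G\<close>. So \<open>J0\<close> has to be transversal to the
    endomorphism \<open>W R\<close>.\<close>
  have "linear (\<lambda>u. sharp (W y0) (R u))"
    using linear_compose[OF linR linW[OF V(2)]] by (simp add: o_def)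
  from ex_complex_structure_transversal[OF assms(1) this] obtain J0 where
    linJ0: "linear J0" and J0: "\<And>u. J0 (J0 u) = - u"
    and injJ0: "inj (\<lambda>u. sharp (W y0) (R u) + J0 u)" by blast
  define T where "T y u = sharp (W y) u + J0 (sharp (G y) u)" for y u
  have linT: "linear (T y)" if "y \<in> V" for y
    unfolding T_def using linear_compose[OF linG[OF that] linJ0] linW[OF that]
    by (intro linear_compose_add) (simp_all add: o_def)
  have bJ0: "bounded_linear J0" using linJ0 by (simp add: linear_conv_bounded_linear)
  have smoothT: "smooth_on V (\<lambda>y. T y u)" for u
    unfolding T_def
    by (intro smooth_on_add V smooth_on_bounded_linear_comp[OF bJ0] smooth_on_sharp G W)
  have "T y0 = (\<lambda>u. sharp (W y0) (R u) + J0 u) \<circ> sharp (G y0)"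
    by (simp add: T_def R fun_eq_iff)
  then have injT0: "inj (T y0)"
    using inj_compose[OF injJ0 inj] by simp
  obtain k where k: "k > 0" "\<forall>\<^sub>F y in at y0. \<forall>u. k * norm u \<le> norm (T y u)"
    using linear_family_bounded_below[where T = T, OF V linT
        smooth_on_imp_continuous_on[OF smoothT] injT0] by blast
  have "inj (T y)" if "\<forall>u. k * norm u \<le> norm (T y u)" "y \<in> V" for y
    unfolding linear_injective_0[OF linT[OF that(2)]]
  proof (intro allI impI)
    fix u assume "T y u = 0"
    then have "k * norm u \<le> 0" using that(1) by (metis norm_zero)
    then show "u = 0" using k(1) by (simp add: mult_le_0_iff)
  qed
  moreover have "\<forall>\<^sub>F y in at y0. y \<in> V" using V by (rule eventually_at_in_open')
  ultimately have "\<forall>\<^sub>F y in at y0. y \<in> V \<and> inj (T y)"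
    using k(2) by (auto elim: eventually_elim2)
  then obtain V' where V': "open V'" "y0 \<in> V'" "\<forall>y\<in>V'. y \<noteq> y0 \<longrightarrow> y \<in> V \<and> inj (T y)"
    unfolding eventually_at_topological by auto
  \<comment> \<open>The filter \<open>at y0\<close> leaves out \<open>y0\<close> itself, where
    injectivity is \<open>injT0\<close>.\<close>
  then have V'_inj: "y \<in> V \<and> inj (T y)" if "y \<in> V'" for y
    using injT0 V(2) that by (cases "y = y0") auto
  define J where "J y u = inv (T y) (J0 (T y u))" for y u
  have T': "linear (T y)" "inj (T y)" "surj (T y)" if "y \<in> V'" for y
    using V'_inj[OF that] linT[of y] linear_inj_imp_surj[of "T y"] by simp_all
  have TJ: "T y (J y u) = J0 (T y u)" if "y \<in> V'" for y u
    unfolding J_def by (rule surj_f_inv_f[OF T'(3)[OF that]])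
  have T_eqD: "u = v" if "T y u = T y v" "y \<in> V'" for y u v
    using injD[OF T'(2)[OF that(2)] that(1)] .
  have T_neg: "T y (- u) = - T y u" if "y \<in> V'" for y u
    by (rule linear_neg[OF T'(1)[OF that]])
  show ?thesis
  proof (rule that[OF V'(1,2)])
    show "V' \<subseteq> V" using V'_inj by blast
    show "linear (J y)" if "y \<in> V'" for y
      using linear_compose[OF linear_compose[OF T'(1)[OF that] linJ0]
        inj_linear_imp_inv_linear[OF T'(1,2)[OF that]]]
      by (simp add: J_def[abs_def] o_def)
    show "J y (J y u) = - u" if "y \<in> V'" for y u
      by (rule T_eqD[OF _ that]) (simp add: TJ[OF that] J0 T_neg[OF that])
    have smoothT': "smooth_on V' (\<lambda>y. T y u)" for u
      using smooth_on_subset[OF smoothT] V'_inj by blast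
    show "smooth_on V' (\<lambda>y. J y u)" for u
      unfolding J_def
      by (rule smooth_on_linear_solve[OF V'(1) T'(1,2) smoothT'
            smooth_on_bounded_linear_comp[OF bJ0 V'(1) smoothT']])
    show "J y u = v" if y: "y \<in> V'" and uv: "\<And>w. W y u w = G y v w" "\<And>w. W y v w = - G y u w"
      for y u v
    proof (rule T_eqD[OF _ y])
      have 1: "sharp (W y) u = sharp (G y) v" using uv(1) by (rule sharp_eqI)
      have 2: "sharp (W y) v = - sharp (G y) u"
        by (simp add: sharp_def uv(2) sum_negf)
      show "T y (J y u) = T y v"
        unfolding TJ[OF y] unfolding T_def 1 2 using linJ0 by (simp add: linear_add J0)
    qed
  qed
qed

subsection \<open>Tensor fields given in one chart\<close>

lemma
  assumes "smooth_manifold A" "c \<in> A"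
  shows open_chart_dom: "open (chart_dom c)"
    and open_chart_image: "U \<subseteq> chart_dom c \<Longrightarrow> open U \<Longrightarrow> open (chart_map c ` U)"
    and open_chart_inv_image:
      "V \<subseteq> chart_map c ` chart_dom c \<Longrightarrow> open V \<Longrightarrow> open (chart_inv c ` V)"
    and chart_inv_chart_map: "x \<in> chart_dom c \<Longrightarrow> chart_inv c (chart_map c x) = x"
    and chart_map_chart_inv: "y \<in> chart_map c ` chart_dom c \<Longrightarrow> chart_map c (chart_inv c y) = y"
    and chart_inv_in_dom: "y \<in> chart_map c ` chart_dom c \<Longrightarrow> chart_inv c y \<in> chart_dom c"
proof -
  have *: "open (chart_dom c)" "open (chart_map c ` chart_dom c)"
    and h: "homeomorphism (chart_dom c) (chart_map c ` chart_dom c) (chart_map c) (chart_inv c)"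
    using assms by (auto simp: smooth_manifold_def)
  show "open (chart_dom c)" by fact
  show 1: "x \<in> chart_dom c \<Longrightarrow> chart_inv c (chart_map c x) = x" for x
    using h by (simp add: homeomorphism_def)
  show 2: "y \<in> chart_map c ` chart_dom c \<Longrightarrow> chart_map c (chart_inv c y) = y" for y
    using 1 by auto
  show 3: "y \<in> chart_map c ` chart_dom c \<Longrightarrow> chart_inv c y \<in> chart_dom c" for y
    using 1 by auto
  have "openin (top_of_set (chart_map c ` chart_dom c)) (chart_map c ` U)"
    if "U \<subseteq> chart_dom c" "open U" for U
    by (rule homeomorphism_imp_open_map[OF h]) (simp add: * that open_openin_trans openin_open_eq)
  then show "U \<subseteq> chart_dom c \<Longrightarrow> open U \<Longrightarrow> open (chart_map c ` U)"
    using *(2) openin_open_trans by blast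
  have "openin (top_of_set (chart_dom c)) (chart_inv c ` V)"
    if "V \<subseteq> chart_map c ` chart_dom c" "open V" for V
    by (rule homeomorphism_imp_open_map[OF homeomorphism_symD[OF h]])
       (simp add: * that openin_open_eq)
  then show "V \<subseteq> chart_map c ` chart_dom c \<Longrightarrow> open V \<Longrightarrow> open (chart_inv c ` V)"
    using *(1) openin_open_trans by blast
qed

section \<open>Transition maps and their derivatives\<close>

lemma smooth_on_transition:
  assumes "smooth_manifold A" "c \<in> A" "d \<in> A"
  shows "smooth_on (chart_map c ` (chart_dom c \<inter> chart_dom d)) (chart_map d \<circ> chart_inv c)"
  using assms by (auto simp: smooth_manifold_def)

lemma open_transition_domain:
  assumes "smooth_manifold A" "c \<in> A" "d \<in> A"
  shows "open (chart_map c ` (chart_dom c \<inter> chart_dom d))"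
  using assms by (intro open_chart_image[OF assms(1,2)] open_Int open_chart_dom[of A]) auto

lemma has_derivative_transition:
  assumes "smooth_manifold A" "c \<in> A" "d \<in> A" "x \<in> chart_dom c" "x \<in> chart_dom d"
  shows "((chart_map d \<circ> chart_inv c) has_derivative transition_deriv c d x) (at (chart_map c x))"
  unfolding transition_deriv_def
  by (rule smooth_on_has_derivative[OF smooth_on_transition[OF assms(1-3)]]) (use assms in auto)

lemma linear_transition_deriv:
  assumes "smooth_manifold A" "c \<in> A" "d \<in> A" "x \<in> chart_dom c" "x \<in> chart_dom d"
  shows "linear (transition_deriv c d x)"
  using has_derivative_transition[OF assms] by (rule has_derivative_linear)

lemma transition_deriv_same:
  assumes "smooth_manifold A" "c \<in> A" "x \<in> chart_dom c"
  shows "transition_deriv c c x u = u"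
proof -
  have "((chart_map c \<circ> chart_inv c) has_derivative (\<lambda>u. u)) (at (chart_map c x))"
    by (rule has_derivative_transform_within_open[OF has_derivative_ident
          open_chart_image[OF assms(1,2) order_refl open_chart_dom[OF assms(1,2)]]])
       (use assms in \<open>auto simp: chart_inv_chart_map\<close>)
  then show ?thesis
    using has_derivative_unique has_derivative_transition[OF assms(1,2,2,3,3)] by metis
qed

lemma transition_deriv_cocycle:
  assumes "smooth_manifold A" "c \<in> A" "d \<in> A" "e \<in> A"
    and x: "x \<in> chart_dom c" "x \<in> chart_dom d" "x \<in> chart_dom e"
  shows "transition_deriv d e x (transition_deriv c d x u) = transition_deriv c e x u"
proof -
  let ?S = "chart_map c ` (chart_dom c \<inter> chart_dom d \<inter> chart_dom e)"
  have eq: "(chart_map d \<circ> chart_inv c) (chart_map c x) = chart_map d x"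
    using assms by (simp add: chart_inv_chart_map)
  have "((chart_map e \<circ> chart_inv d) has_derivative transition_deriv d e x)
      (at ((chart_map d \<circ> chart_inv c) (chart_map c x)))"
    unfolding eq by (rule has_derivative_transition) (use assms in auto)
  from has_derivative_compose[OF has_derivative_transition[OF assms(1-3) x(1,2)] this]
  have D: "((\<lambda>y. (chart_map e \<circ> chart_inv d) ((chart_map d \<circ> chart_inv c) y)) has_derivative
     (\<lambda>u. transition_deriv d e x (transition_deriv c d x u))) (at (chart_map c x))" .
  have "open ?S"
    using assms by (intro open_chart_image[OF assms(1,2)] open_Int open_chart_dom[of A]) auto
  then have "((chart_map e \<circ> chart_inv c) has_derivative
     (\<lambda>u. transition_deriv d e x (transition_deriv c d x u))) (at (chart_map c x))"
    by (rule has_derivative_transform_within_open[OF D])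
       (use assms in \<open>auto simp: chart_inv_chart_map[OF assms(1)]\<close>)
  then show ?thesis
    using has_derivative_unique[OF has_derivative_transition[OF assms(1,2,4) x(1,3)]] by metis
qed

section \<open>Tangent vectors and their coordinates\<close>

lemma tangent_spaceI:
  assumes "\<And>c. \<not> (c \<in> A \<and> x \<in> chart_dom c) \<Longrightarrow> v c = 0"
    "\<And>c d. c \<in> A \<Longrightarrow> x \<in> chart_dom c \<Longrightarrow> d \<in> A \<Longrightarrow> x \<in> chart_dom d \<Longrightarrow>
      v d = transition_deriv c d x (v c)"
  shows "v \<in> tangent_space A x"
  using assms unfolding tangent_space_def by blast

lemma
  assumes "v \<in> tangent_space A x"
  shows tangent_space_outside: "\<not> (c \<in> A \<and> x \<in> chart_dom c) \<Longrightarrow> v c = 0"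
    and tangent_space_transition: "c \<in> A \<Longrightarrow> x \<in> chart_dom c \<Longrightarrow> d \<in> A \<Longrightarrow> x \<in> chart_dom d \<Longrightarrow>
      v d = transition_deriv c d x (v c)"
  using assms unfolding tangent_space_def by blast+

lemma coord_tvec_in_tangent_space:
  assumes "smooth_manifold A" "c \<in> A" "x \<in> chart_dom c"
  shows "coord_tvec A c x u \<in> tangent_space A x"
  using assms by (intro tangent_spaceI) (auto simp: coord_tvec_def transition_deriv_cocycle)

lemma coord_tvec_same:
  assumes "smooth_manifold A" "c \<in> A" "x \<in> chart_dom c"
  shows "coord_tvec A c x u c = u"
  using assms by (simp add: coord_tvec_def transition_deriv_same)

lemma coord_tvec_coords:
  assumes "c \<in> A" "x \<in> chart_dom c" "v \<in> tangent_space A x"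
  shows "coord_tvec A c x (v c) = v"
proof
  fix d
  show "coord_tvec A c x (v c) d = v d"
    using tangent_space_outside[OF assms(3), of d] tangent_space_transition[OF assms(3,1,2), of d]
    by (auto simp: coord_tvec_def)
qed

lemma tangent_space_eqI:
  assumes "c \<in> A" "x \<in> chart_dom c" "u \<in> tangent_space A x" "v \<in> tangent_space A x" "u c = v c"
  shows "u = v"
  using coord_tvec_coords[OF assms(1-3)] coord_tvec_coords[OF assms(1,2,4)] assms(5) by metis

lemma lincomb_in_tangent_space:
  assumes "smooth_manifold A" "u \<in> tangent_space A x" "v \<in> tangent_space A x"
  shows "lincomb a u b v \<in> tangent_space A x"
proof (rule tangent_spaceI)
  fix c assume "\<not> (c \<in> A \<and> x \<in> chart_dom c)"
  then show "lincomb a u b v c = 0"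
    using tangent_space_outside[OF assms(2)] tangent_space_outside[OF assms(3)]
    by (simp add: lincomb_def)
next
  fix c d assume cd: "c \<in> A" "x \<in> chart_dom c" "d \<in> A" "x \<in> chart_dom d"
  note lin = linear_transition_deriv[OF assms(1) cd(1,3,2,4)]
  show "lincomb a u b v d = transition_deriv c d x (lincomb a u b v c)"
    using tangent_space_transition[OF assms(2) cd] tangent_space_transition[OF assms(3) cd]
    by (simp add: lincomb_def linear_add[OF lin] linear_cmul[OF lin])
qed

lemma neg_tvec_in_tangent_space:
  assumes "smooth_manifold A" "u \<in> tangent_space A x"
  shows "neg_tvec u \<in> tangent_space A x"
  using lincomb_in_tangent_space[OF assms assms(2), of "-1" 0]
  by (simp add: lincomb_def neg_tvec_def)

lemma zero_tvec_in_tangent_space: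
  assumes "smooth_manifold A"
  shows "zero_tvec \<in> tangent_space A x"
  by (rule tangent_spaceI) (simp_all add: zero_tvec_def linear_0[OF linear_transition_deriv[OF assms]])

text \<open>The neighbourhood will lie in one chart, so new fields are prescribed by their
  components there. The behaviour in the other charts of the atlas is left to the smoothness
  lemmas.\<close>

definition chart_tensor ::
  "('a, 'e::euclidean_space) chart \<Rightarrow> ('e \<Rightarrow> 'e \<Rightarrow> 'e \<Rightarrow> real) \<Rightarrow> ('a, 'e) tensor2" where
  "chart_tensor c B x u v = B (chart_map c x) (u c) (v c)"

definition chart_endo ::
  "('a, 'e::euclidean_space) chart set \<Rightarrow> ('a, 'e) chart \<Rightarrow> ('e \<Rightarrow> 'e \<Rightarrow> 'e) \<Rightarrow> ('a, 'e) endo_field" where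
  "chart_endo A c J x u = coord_tvec A c x (J (chart_map c x) (u c))"

lemma chart_inv_imageD:
  assumes "smooth_manifold A" "c \<in> A" "V \<subseteq> chart_map c ` chart_dom c" "x \<in> chart_inv c ` V"
  shows "x \<in> chart_dom c" "chart_map c x \<in> V"
  using assms chart_inv_in_dom[OF assms(1,2)] chart_map_chart_inv[OF assms(1,2)] by auto

text \<open>Smoothness of a field has to be checked in every chart \<open>d\<close>.
  \<open>S\<close> is the neighbourhood seen in \<open>d\<close>, and the last claim converts
  constant coordinate vectors of \<open>d\<close> into components with respect to
  \<open>c\<close>.\<close>

lemma transition_to_chart:
  assumes "smooth_manifold A" "c \<in> A" "d \<in> A" "open V" "V \<subseteq> chart_map c ` chart_dom c"
  defines "S \<equiv> chart_map d ` (chart_dom d \<inter> chart_inv c ` V)"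
  shows "open S" "(chart_map c \<circ> chart_inv d) ` S \<subseteq> V"
    "S \<subseteq> chart_map d ` (chart_dom d \<inter> chart_dom c)"
    "smooth_on S (chart_map c \<circ> chart_inv d)"
    "y \<in> S \<Longrightarrow> coord_tvec A d (chart_inv d y) u c
      = frechet_derivative (chart_map c \<circ> chart_inv d) (at y) u"
proof -
  note U = chart_inv_imageD[OF assms(1,2,5)]
  show "open S"
    unfolding S_def
    using assms by (intro open_chart_image[OF assms(1,3)] open_Int open_chart_dom[of A]
        open_chart_inv_image[OF assms(1,2)]) auto
  show "(chart_map c \<circ> chart_inv d) ` S \<subseteq> V"
    using U assms by (auto simp: chart_inv_chart_map)
  show *: "S \<subseteq> chart_map d ` (chart_dom d \<inter> chart_dom c)"
    using U by (auto simp: S_def)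
  show "smooth_on S (chart_map c \<circ> chart_inv d)"
    by (rule smooth_on_subset[OF smooth_on_transition[OF assms(1,3,2)] *])
  assume "y \<in> S"
  then show "coord_tvec A d (chart_inv d y) u c
      = frechet_derivative (chart_map c \<circ> chart_inv d) (at y) u"
    using assms U
    by (auto simp: coord_tvec_def transition_deriv_def chart_inv_chart_map)
qed

text \<open>In another chart the components are the pullback of \<open>B\<close> along the
  transition map \<open>?t\<close>: the form at \<open>?t y\<close> evaluated on two derivatives of
  \<open>?t\<close>, all of them smooth.\<close>

lemma smooth_tensor2_chart_tensor:
  assumes A: "smooth_manifold A" "c \<in> A" and V: "open V" "V \<subseteq> chart_map c ` chart_dom c"
    and B: "\<And>y. y \<in> V \<Longrightarrow> bilinear (B y)" "\<And>u v. smooth_on V (\<lambda>y. B y u v)"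
  shows "smooth_tensor2 A (chart_inv c ` V) (chart_tensor c B)"
  unfolding smooth_tensor2_def
proof (intro conjI ballI allI)
  fix x u v w and a b :: real
  assume "x \<in> chart_inv c ` V"
  then have "bilinear (B (chart_map c x))"
    by (intro B(1) chart_inv_imageD[OF A V(2)])
  then show "chart_tensor c B x (lincomb a u b v) w = a * chart_tensor c B x u w + b * chart_tensor c B x v w"
    and "chart_tensor c B x w (lincomb a u b v) = a * chart_tensor c B x w u + b * chart_tensor c B x w v"
    by (simp_all add: chart_tensor_def lincomb_def bilinear_ladd bilinear_lmul bilinear_radd bilinear_rmul)
next
  fix d u v assume d: "d \<in> A"
  let ?S = "chart_map d ` (chart_dom d \<inter> chart_inv c ` V)"
  let ?t = "chart_map c \<circ> chart_inv d"
  note t = transition_to_chart[OF A d V]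
  have Bt: "smooth_on ?S (\<lambda>y. B (?t y) u v)" for u v
    by (rule smooth_on_compose[OF t(1) V(1) t(2) B(2) t(4)])
  have "smooth_on ?S (\<lambda>y. B (?t y) (frechet_derivative ?t (at y) u) (frechet_derivative ?t (at y) v))"
    using t(2)
    by (intro smooth_on_bilinear_apply[where B = "\<lambda>y. B (?t y)", OF t(1) B(1) Bt]
        smooth_on_frechet_derivative t(4)) blast
  then show "smooth_on ?S (\<lambda>y. chart_tensor c B (chart_inv d y)
      (coord_tvec A d (chart_inv d y) u) (coord_tvec A d (chart_inv d y) v))"
    by (rule smooth_on_cong[OF t(1), rotated]) (simp only: chart_tensor_def t(5) o_apply)
qed

text \<open>In another chart \<open>J\<close> appears conjugated by the derivatives of the
  transition maps: \<open>?t\<close> leads into \<open>c\<close> and \<open>?s\<close> back to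
  \<open>d\<close>.\<close>

lemma almost_complex_structure_chart_endo:
  assumes A: "smooth_manifold A" "c \<in> A" and V: "open V" "V \<subseteq> chart_map c ` chart_dom c"
    and J: "\<And>y. y \<in> V \<Longrightarrow> linear (J y)" "\<And>u. smooth_on V (\<lambda>y. J y u)"
      "\<And>y u. y \<in> V \<Longrightarrow> J y (J y u) = - u"
  shows "almost_complex_structure A (chart_inv c ` V) (chart_endo A c J)"
  unfolding almost_complex_structure_def
proof (intro conjI ballI allI)
  fix x u
  assume "x \<in> chart_inv c ` V" and u: "u \<in> tangent_space A x"
  note x = chart_inv_imageD[OF A V(2) this(1)]
  show Jx: "chart_endo A c J x u \<in> tangent_space A x" for u
    unfolding chart_endo_def by (rule coord_tvec_in_tangent_space[OF A x(1)])
  show "chart_endo A c J x (chart_endo A c J x u) = neg_tvec u"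
    by (rule tangent_space_eqI[OF A(2) x(1) Jx neg_tvec_in_tangent_space[OF A(1) u]])
       (simp add: chart_endo_def coord_tvec_same[OF A x(1)] J(3)[OF x(2)] neg_tvec_def)
  show "chart_endo A c J x (lincomb a u b v) = lincomb a (chart_endo A c J x u) b (chart_endo A c J x v)"
    for a b v
    using J(1)[OF x(2)]
    by (intro tangent_space_eqI[OF A(2) x(1) Jx lincomb_in_tangent_space[OF A(1) Jx Jx]])
       (simp add: chart_endo_def coord_tvec_same[OF A x(1)] lincomb_def linear_add linear_cmul)
next
  fix d u assume d: "d \<in> A"
  let ?S = "chart_map d ` (chart_dom d \<inter> chart_inv c ` V)"
  let ?t = "chart_map c \<circ> chart_inv d" and ?s = "chart_map d \<circ> chart_inv c"
  note t = transition_to_chart[OF A d V]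
  note s = smooth_on_transition[OF A d]
  have t_image: "?t ` ?S \<subseteq> chart_map c ` (chart_dom c \<inter> chart_dom d)"
  proof (rule image_subsetI)
    fix y assume "y \<in> ?S"
    then obtain x where x: "y = chart_map d x" "x \<in> chart_dom d" "x \<in> chart_inv c ` V" by blast
    then show "?t y \<in> chart_map c ` (chart_dom c \<inter> chart_dom d)"
      using chart_inv_imageD(1)[OF A V(2) x(3)] by (simp add: chart_inv_chart_map[OF A(1) d])
  qed
  have linJ: "linear (J (?t y))" if "y \<in> ?S" for y
    using that t(2) by (intro J(1)) blast
  have lins: "linear (frechet_derivative ?s (at (?t y)))" if "y \<in> ?S" for y
    by (rule has_derivative_linear[OF smooth_on_has_derivative[OF s]]) (use that t_image in blast)
  have "smooth_on ?S (\<lambda>y. frechet_derivative ?s (at (?t y))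
      (J (?t y) (frechet_derivative ?t (at y) u)))"
    by (rule smooth_on_apply[where T = "\<lambda>y. frechet_derivative ?s (at (?t y))", OF t(1) lins
          smooth_on_compose[OF t(1) open_transition_domain[OF A d] t_image
            smooth_on_frechet_derivative[OF s] t(4)]
          smooth_on_apply[where T = "\<lambda>y. J (?t y)", OF t(1) linJ
            smooth_on_compose[OF t(1) V(1) t(2) J(2) t(4)] smooth_on_frechet_derivative[OF t(4)]]])
  then show "smooth_on ?S (\<lambda>y. chart_endo A c J (chart_inv d y) (coord_tvec A d (chart_inv d y) u) d)"
  proof (rule smooth_on_cong[OF t(1), rotated])
    fix y assume y: "y \<in> ?S"
    then have "chart_inv d y \<in> chart_dom d"
      by (auto simp: chart_inv_chart_map[OF A(1) d])
    then show "frechet_derivative ?s (at (?t y)) (J (?t y) (frechet_derivative ?t (at y) u))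
      = chart_endo A c J (chart_inv d y) (coord_tvec A d (chart_inv d y) u) d"
      using d by (simp only: chart_endo_def t(5)[OF y]) (simp add: coord_tvec_def transition_deriv_def)
  qed
qed

subsection \<open>Hermitian structures\<close>

definition hermitian :: "('e::real_vector \<Rightarrow> 'e \<Rightarrow> real) \<Rightarrow> ('e \<Rightarrow> 'e) \<Rightarrow> bool" where
  "hermitian G J \<longleftrightarrow> bilinear G \<and> (\<forall>u v. G u v = G v u) \<and> (\<forall>u. u \<noteq> 0 \<longrightarrow> G u u > 0) \<and>
     linear J \<and> (\<forall>u. J (J u) = - u) \<and> (\<forall>u v. G (J u) (J v) = G u v)"

lemma
  assumes "hermitian G J"
  shows hermitian_bilinear: "bilinear G" and hermitian_sym: "G u v = G v u"
    and hermitian_pos: "u \<noteq> 0 \<Longrightarrow> G u u > 0" and hermitian_linear: "linear J"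
    and hermitian_square: "J (J u) = - u" and hermitian_invariant: "G (J u) (J v) = G u v"
  using assms unfolding hermitian_def by blast+

text \<open>Invariance under \<open>J\<close> and \<open>J (J u) = - u\<close> show that
  \<open>G (J u) u\<close> equals its own negative.\<close>

lemma hermitian_alternating:
  assumes "hermitian G J"
  shows "G (J u) u = 0"
proof -
  have "G (J u) u = G (J (J u)) (J u)" using hermitian_invariant[OF assms] by metis
  also have "\<dots> = - G (J u) u"
    using hermitian_sym[OF assms, of u "J u"]
    by (simp add: hermitian_square[OF assms] bilinear_lneg[OF hermitian_bilinear[OF assms]])
  finally show ?thesis by simp
qed

text \<open>Wirtinger's inequality for 2-planes, read off from
  \<open>G (J u - v) (J u - v) \<ge> 0\<close> as \<open>J\<close> is an isometry. It bounds the
  comass from above.\<close>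

lemma hermitian_form_le_1:
  assumes "hermitian G J" "G u u = 1" "G v v = 1"
  shows "G (J u) v \<le> 1"
proof -
  note B = hermitian_bilinear[OF assms(1)]
  have "0 \<le> G (J u - v) (J u - v)"
    using hermitian_pos[OF assms(1), of "J u - v"] bilinear_lzero[OF B] by force
  also have "\<dots> = G (J u) (J u) + G v v - 2 * G (J u) v"
    using hermitian_sym[OF assms(1), of v "J u"]
    by (simp add: bilinear_lsub[OF B] bilinear_rsub[OF B])
  finally show ?thesis
    using assms hermitian_invariant[OF assms(1)] by simp
qed

text \<open>Averaging over the group generated by \<open>J\<close>; since -1 acts trivially on
  bilinear forms, two summands suffice.\<close>

lemma hermitian_average:
  assumes "bilinear G" "\<And>u v. G u v = G v u" "\<And>u. u \<noteq> 0 \<Longrightarrow> G u u > 0"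
    and "linear J" "\<And>u. J (J u) = - u"
  shows "hermitian (\<lambda>u v. (G u v + G (J u) (J v)) / 2) J"
  unfolding hermitian_def
proof (intro conjI allI impI)
  show "bilinear (\<lambda>u v. (G u v + G (J u) (J v)) / 2)"
    unfolding bilinear_def
    by (auto intro!: linearI simp: linear_add[OF assms(4)] linear_cmul[OF assms(4)]
        bilinear_ladd[OF assms(1)] bilinear_radd[OF assms(1)] bilinear_lmul[OF assms(1)]
        bilinear_rmul[OF assms(1)] field_simps)
  show "0 < (G u u + G (J u) (J u)) / 2" if "u \<noteq> 0" for u
  proof -
    have "J u \<noteq> 0" using that assms(5)[of u] linear_0[OF assms(4)] by auto
    then show ?thesis using assms(3)[OF that] assms(3)[of "J u"] by simp
  qed
  show "(G (J u) (J v) + G (J (J u)) (J (J v))) / 2 = (G u v + G (J u) (J v)) / 2" for u v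
    by (simp add: assms(5) bilinear_lneg[OF assms(1)] bilinear_rneg[OF assms(1)])
qed (use assms in auto)

text \<open>Everything except the statements on calibrated planes, for an arbitrary smooth field of
  Hermitian structures in a chart. Evaluating \<open>\<Omega>\<close> on \<open>u\<close> and
  \<open>j u\<close> gives the metric, which yields non-degeneracy and the relation between
  \<open>\<Omega>\<close>, \<open>g\<close> and \<open>j\<close>.\<close>

lemma semi_calibration_chart:
  fixes A :: "('a::{t2_space,second_countable_topology}, 'e::euclidean_space) chart set"
  assumes A: "smooth_manifold A" "c \<in> A"
    and V: "open V" "V \<subseteq> chart_map c ` chart_dom c" "V \<noteq> {}"
    and GJ: "\<And>y. y \<in> V \<Longrightarrow> hermitian (G y) (J y)"
    and smooth: "\<And>u v. smooth_on V (\<lambda>y. G y u v)" "\<And>u. smooth_on V (\<lambda>y. J y u)"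
  defines "U \<equiv> chart_inv c ` V" and "\<Omega> \<equiv> chart_tensor c (\<lambda>y u v. G y (J y u) v)"
    and "g \<equiv> chart_tensor c G" and "j \<equiv> chart_endo A c J"
  shows "two_form A U \<Omega>" "nondegenerate A U \<Omega>" "riemannian_metric A U g"
    "semi_calibration A U g \<Omega>" "uniquely_defines_acs A U \<Omega> g j"
proof -
  have x: "x \<in> chart_dom c" "chart_map c x \<in> V" if "x \<in> U" for x
    using chart_inv_imageD[OF A V(2)] that unfolding U_def by blast+
  note H = GJ[OF x(2)]
  have eqI: "u = v" if "x \<in> U" "u \<in> tangent_space A x" "v \<in> tangent_space A x" "u c = v c" for x u v
    using tangent_space_eqI[OF A(2) x(1)[OF that(1)] that(2-4)] .
  have nz: "u c \<noteq> 0" if "x \<in> U" "u \<in> tangent_space A x" "u \<noteq> zero_tvec" for x u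
    using eqI[OF that(1,2) zero_tvec_in_tangent_space[OF A(1)]] that(3) by (auto simp: zero_tvec_def)
  have coord: "coord_tvec A c x u \<in> tangent_space A x" "coord_tvec A c x u c = u" if "x \<in> U" for x u
    using coord_tvec_in_tangent_space[OF A x(1)[OF that]] coord_tvec_same[OF A x(1)[OF that]] by blast+
  have jc: "j x u c = J (chart_map c x) (u c)" if "x \<in> U" for x u
    unfolding j_def chart_endo_def by (rule coord(2)[OF that])
  have bil: "bilinear (\<lambda>u v. G y (J y u) v)" if "y \<in> V" for y
    using hermitian_bilinear[OF GJ[OF that]] linear_compose[OF hermitian_linear[OF GJ[OF that]]]
    unfolding bilinear_def o_def by blast
  have smooth': "smooth_on V (\<lambda>y. G y (J y u) v)" for u v
    by (rule smooth_on_bilinear_apply[OF V(1) hermitian_bilinear[OF GJ] smooth smooth_on_const])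
  show two: "two_form A U \<Omega>"
    unfolding two_form_def U_def \<Omega>_def
    using smooth_tensor2_chart_tensor[OF A V(1,2) bil smooth'] hermitian_alternating[OF H]
    by (auto simp: chart_tensor_def U_def)
  show "riemannian_metric A U g"
    unfolding riemannian_metric_def g_def
    using smooth_tensor2_chart_tensor[OF A V(1,2) hermitian_bilinear[OF GJ] smooth(1)]
      hermitian_sym[OF H] hermitian_pos[OF H] nz
    by (auto simp: chart_tensor_def U_def)
  have \<Omega>j: "\<Omega> x u (j x v) = g x u v" if "x \<in> U" for x u v
    using hermitian_invariant[OF H[OF that]] jc[OF that]
    by (simp add: \<Omega>_def g_def chart_tensor_def)
  \<comment> \<open>The test vector \<open>- J ?y w\<close> turns \<open>\<Omega>\<close> into
    \<open>G ?y w\<close>; with \<open>w\<close> the difference of the two vectors this gives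
    \<open>G ?y w w = 0\<close>. Applied to the values of two compatible structures it yields
    uniqueness of \<open>J\<close>.\<close>
  have inj: "w = 0" if "x \<in> U" "\<And>u. \<Omega> x (coord_tvec A c x u) v = \<Omega> x (coord_tvec A c x u) v'"
    "w = v c - v' c" for x v v' w
  proof (rule ccontr)
    let ?y = "chart_map c x"
    assume "w \<noteq> 0"
    have "\<Omega> x (coord_tvec A c x (- J ?y w)) v'' = G ?y w (v'' c)" for v''
      using hermitian_square[OF H[OF that(1)], of w]
      by (simp add: \<Omega>_def chart_tensor_def coord(2)[OF that(1)] linear_neg[OF hermitian_linear[OF H[OF that(1)]]])
    then have "G ?y w w = 0"
      using that(2)[of "- J ?y w"] bilinear_rsub[OF hermitian_bilinear[OF H[OF that(1)]]]
      by (simp add: that(3))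
    then show False using hermitian_pos[OF H[OF that(1)] \<open>w \<noteq> 0\<close>] by simp
  qed
  show "nondegenerate A U \<Omega>"
    unfolding nondegenerate_def
  proof (intro ballI impI)
    fix x u assume "x \<in> U" "u \<in> tangent_space A x" "\<forall>v\<in>tangent_space A x. \<Omega> x u v = 0"
    moreover have "j x u \<in> tangent_space A x"
      using coord(1)[OF \<open>x \<in> U\<close>] by (simp add: j_def chart_endo_def)
    ultimately have "G (chart_map c x) (u c) (u c) = 0"
      using \<Omega>j[OF \<open>x \<in> U\<close>, of u u] by (simp add: g_def chart_tensor_def)
    then show "u = zero_tvec"
      using nz[OF \<open>x \<in> U\<close> \<open>u \<in> tangent_space A x\<close>] hermitian_pos[OF H[OF \<open>x \<in> U\<close>], of "u c"] by force
  qed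
  show "uniquely_defines_acs A U \<Omega> g j"
    unfolding uniquely_defines_acs_def
  proof (intro conjI allI impI ballI)
    show "almost_complex_structure A U j"
      unfolding U_def j_def
      by (rule almost_complex_structure_chart_endo[OF A V(1,2) hermitian_linear[OF GJ] smooth(2)
            hermitian_square[OF GJ]])
    show "compatible_triple A U \<Omega> g j"
      using \<Omega>j by (simp add: compatible_triple_def)
    fix j' x v
    assume j': "almost_complex_structure A U j' \<and> compatible_triple A U \<Omega> g j'"
      and "x \<in> U" and v: "v \<in> tangent_space A x"
    then have "\<Omega> x (coord_tvec A c x u) (j' x v) = \<Omega> x (coord_tvec A c x u) (j x v)" for u
      using coord(1)[OF \<open>x \<in> U\<close>] \<Omega>j[OF \<open>x \<in> U\<close>] by (simp add: compatible_triple_def)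
    then have "j' x v c - j x v c = 0"
      by (rule inj[OF \<open>x \<in> U\<close> _ refl])
    moreover have "j' x v \<in> tangent_space A x"
      using j' \<open>x \<in> U\<close> v by (simp add: almost_complex_structure_def)
    moreover have "j x v \<in> tangent_space A x"
      using coord(1)[OF \<open>x \<in> U\<close>] by (simp add: j_def chart_endo_def)
    ultimately show "j' x v = j x v"
      using eqI[OF \<open>x \<in> U\<close>] by simp
  qed
  have le: "\<Omega> x u v \<le> 1" if "x \<in> U" "orthonormal_pair (g x) u v" for x u v
    using that hermitian_form_le_1[OF H[OF that(1)]]
    by (simp add: \<Omega>_def g_def chart_tensor_def orthonormal_pair_def)
  \<comment> \<open>Attaining the supremum takes a single plane: at any point of the nonempty set, a
    basis vector normalised to \<open>u\<close> and its image \<open>J u\<close> are orthonormal,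
    and the form takes the value \<open>G (J u) (J u) = 1\<close>.\<close>
  obtain y where "y \<in> V" using V(3) by blast
  define x where "x = chart_inv c y"
  have "x \<in> U" using \<open>y \<in> V\<close> by (simp add: x_def U_def)
  obtain b :: 'e where "b \<in> Basis" using nonempty_Basis by blast
  then have "b \<noteq> 0" by auto
  let ?y = "chart_map c x"
  define u where "u = (1 / sqrt (G ?y b b)) *\<^sub>R b"
  note B = hermitian_bilinear[OF H[OF \<open>x \<in> U\<close>]]
  have u: "G ?y u u = 1"
    using hermitian_pos[OF H[OF \<open>x \<in> U\<close>] \<open>b \<noteq> 0\<close>]
    by (simp add: u_def bilinear_lmul[OF B] bilinear_rmul[OF B] field_simps)
  let ?u = "coord_tvec A c x u" and ?v = "coord_tvec A c x (J ?y u)"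
  have "orthonormal_pair (g x) ?u ?v" "\<Omega> x ?u ?v = 1"
    using u hermitian_invariant[OF H[OF \<open>x \<in> U\<close>]] hermitian_alternating[OF H[OF \<open>x \<in> U\<close>]]
      hermitian_sym[OF H[OF \<open>x \<in> U\<close>], of u "J ?y u"]
    by (simp_all add: orthonormal_pair_def \<Omega>_def g_def chart_tensor_def coord(2)[OF \<open>x \<in> U\<close>])
  with coord(1)[OF \<open>x \<in> U\<close>] \<open>x \<in> U\<close> have
    "1 \<in> {ereal (\<Omega> x u v) |x u v. x \<in> U \<and> u \<in> tangent_space A x \<and> v \<in> tangent_space A x \<and>
            orthonormal_pair (g x) u v}"
    by (smt (verit) mem_Collect_eq one_ereal_def)
  then have "comass A U g \<Omega> = 1"
    unfolding comass_def by (intro antisym Sup_upper Sup_least) (auto dest: le)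
  with two show "semi_calibration A U g \<Omega>"
    by (simp add: semi_calibration_def)
qed

subsection \<open>Calibrated planes\<close>

text \<open>For \<open>z\<close> orthogonal to \<open>u, v\<close> the comass bound for \<open>u\<close> and \<open>v + t z\<close> is \<open>1 + t W(u, z) \<le> sqrt (1 + t\<^sup>2 G(z, z))\<close>,
  which fails for suitable \<open>t\<close> unless \<open>W(u, z) = 0\<close>.\<close>

lemma calibrated_pair_dual:
  fixes G W :: "'e::real_vector \<Rightarrow> 'e \<Rightarrow> real"
  assumes G: "bilinear G" "\<And>u v. G u v = G v u" "\<And>u. u \<noteq> 0 \<Longrightarrow> G u u > 0"
    and W: "bilinear W"
    and le: "\<And>a b. G a a = 1 \<Longrightarrow> G b b = 1 \<Longrightarrow> G a b = 0 \<Longrightarrow> W a b \<le> 1"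
    and uv: "G u u = 1" "G v v = 1" "G u v = 0" "W u v = 1" and "W u u = 0"
  shows "W u w = G v w"
proof -
  note bil = bilinear_ladd[OF G(1)] bilinear_radd[OF G(1)] bilinear_lmul[OF G(1)] bilinear_rmul[OF G(1)]
    bilinear_lsub[OF G(1)] bilinear_rsub[OF G(1)]
    bilinear_radd[OF W] bilinear_rmul[OF W] bilinear_rsub[OF W]
  have nonneg: "G z z \<ge> 0" for z
    using G(3)[of z] bilinear_lzero[OF G(1)] by (cases "z = 0") auto
  define z where "z = w - G u w *\<^sub>R u - G v w *\<^sub>R v"
  have z: "G u z = 0" "G v z = 0" "G z v = 0"
    using uv G(2)[of v u] G(2)[of z v] by (simp_all add: z_def bil)
  define s k where "s = W u z" and "k = G z z"
  have "k \<ge> 0" using nonneg by (simp add: k_def)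
  \<comment> \<open>Chosen so that \<open>t\<^sup>2 * (1 + k) = t * s\<close>. The comass bound
    \<open>2 * (t * s) \<le> t\<^sup>2 * k\<close> then forces \<open>t * s \<le> 0\<close>,
    although \<open>t * s\<close> is a nonnegative multiple of \<open>s * s\<close>.\<close>
  define t where "t = s / (1 + k)"
  define b where "b = v + t *\<^sub>R z"
  have Gbb: "G b b = 1 + t\<^sup>2 * k"
    by (simp add: b_def bil uv z k_def power2_eq_square)
  then have "G b b > 0" using \<open>k \<ge> 0\<close> by (simp add: add_pos_nonneg)
  let ?r = "sqrt (G b b)"
  have r: "?r > 0" "?r * ?r = G b b" using \<open>G b b > 0\<close> by simp_all
  have "W u ((1 / ?r) *\<^sub>R b) \<le> 1"
    using r uv z by (intro le) (simp_all add: bil b_def[symmetric] field_simps, simp add: b_def bil)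
  then have "W u b \<le> ?r" using r(1) by (simp add: bil field_simps)
  moreover have "W u b = 1 + t * s" by (simp add: b_def bil uv s_def)
  moreover have "t * s \<ge> 0" using \<open>k \<ge> 0\<close> by (simp add: t_def)
  \<comment> \<open>Squaring is legitimate because \<open>t * s\<close> is nonnegative; the quartic
    term is discarded afterwards.\<close>
  ultimately have "(1 + t * s) * (1 + t * s) \<le> ?r * ?r"
    using \<open>G b b > 0\<close> by (intro mult_mono) auto
  then have "(1 + t * s) * (1 + t * s) \<le> 1 + t\<^sup>2 * k" using r(2) Gbb by simp
  moreover have "(t * s) * (t * s) \<ge> 0" by simp
  ultimately have "2 * (t * s) \<le> t\<^sup>2 * k" by (simp add: algebra_simps)
  also have "t\<^sup>2 * k \<le> t\<^sup>2 * (1 + k)" by (intro mult_left_mono) auto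
  also have "t\<^sup>2 * (1 + k) = t * s" using \<open>k \<ge> 0\<close> by (simp add: t_def power2_eq_square)
  finally have "t * s \<le> 0" by linarith
  then have "s * s \<le> 0" using \<open>k \<ge> 0\<close> by (simp add: t_def divide_le_0_iff)
  then have "s = 0" by (auto simp: mult_le_0_iff)
  then show ?thesis
    using uv \<open>W u u = 0\<close> by (simp add: s_def z_def bil)
qed

text \<open>A pair satisfying the first-order conditions stays orthonormal for the averaged metric
  because \<open>J\<close> takes \<open>u\<close> to \<open>v\<close> and \<open>v\<close> to
  \<open>- u\<close>, so both summands of \<open>H\<close> agree on it.\<close>

lemma ex_local_hermitian:
  fixes G W :: "'e::euclidean_space \<Rightarrow> 'e \<Rightarrow> 'e \<Rightarrow> real"
  assumes "even DIM('e)" and V: "open V" "y0 \<in> V"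
    and G: "\<And>y. y \<in> V \<Longrightarrow> bilinear (G y)" "\<And>u v. smooth_on V (\<lambda>y. G y u v)"
    and G_sym: "\<And>y u v. y \<in> V \<Longrightarrow> G y u v = G y v u"
    and G_pos: "\<And>y u. y \<in> V \<Longrightarrow> u \<noteq> 0 \<Longrightarrow> G y u u > 0"
    and W: "\<And>y. y \<in> V \<Longrightarrow> bilinear (W y)" "\<And>u v. smooth_on V (\<lambda>y. W y u v)"
  obtains V' H J where "open V'" "y0 \<in> V'" "V' \<subseteq> V"
    "\<And>y. y \<in> V' \<Longrightarrow> hermitian (H y) (J y)"
    "\<And>u v. smooth_on V' (\<lambda>y. H y u v)" "\<And>u. smooth_on V' (\<lambda>y. J y u)"
    "\<And>y u v. y \<in> V' \<Longrightarrow> G y u u = 1 \<Longrightarrow> G y v v = 1 \<Longrightarrow> G y u v = 0 \<Longrightarrow>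
      (\<And>w. W y u w = G y v w) \<Longrightarrow> (\<And>w. W y v w = - G y u w) \<Longrightarrow>
      J y u = v \<and> J y v = - u \<and> H y u u = 1 \<and> H y v v = 1 \<and> H y u v = 0"
proof -
  obtain V' J where V': "open V'" "y0 \<in> V'" "V' \<subseteq> V"
    and J: "\<And>y. y \<in> V' \<Longrightarrow> linear (J y)" "\<And>y u. y \<in> V' \<Longrightarrow> J y (J y u) = - u"
      "\<And>u. smooth_on V' (\<lambda>y. J y u)"
      "\<And>y u v. y \<in> V' \<Longrightarrow> (\<And>w. W y u w = G y v w) \<Longrightarrow> (\<And>w. W y v w = - G y u w) \<Longrightarrow> J y u = v"
    using ex_local_complex_structure[where G = G and W = W, OF assms(1) V G G_pos W] by blast
  define H where "H y u v = (G y u v + G y (J y u) (J y v)) / 2" for y u v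
  have G': "bilinear (G y)" "\<And>u v. G y u v = G y v u" "\<And>u. u \<noteq> 0 \<Longrightarrow> G y u u > 0" if "y \<in> V'" for y
    using V'(3) that G G_sym G_pos by blast+
  have smoothG: "smooth_on V' (\<lambda>y. G y u v)" for u v
    by (rule smooth_on_subset[OF G(2) V'(3)])
  show ?thesis
  proof (rule that[OF V'])
    show "hermitian (H y) (J y)" if "y \<in> V'" for y
      using hermitian_average[OF G'[OF that] J(1,2)[OF that]] by (simp add: H_def[abs_def])
    have "smooth_on V' (\<lambda>y. (1/2) *\<^sub>R (G y u v + G y (J y u) (J y v)))" for u v
      by (intro smooth_on_scaleR smooth_on_add smooth_on_const V' smoothG J
          smooth_on_bilinear_apply[OF V'(1) G'(1) smoothG])
    then show "smooth_on V' (\<lambda>y. H y u v)" for u v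
      by (simp add: H_def)
    show "smooth_on V' (\<lambda>y. J y u)" for u by (rule J(3))
    show "J y u = v \<and> J y v = - u \<and> H y u u = 1 \<and> H y v v = 1 \<and> H y u v = 0"
      if y: "y \<in> V'" and uv: "G y u u = 1" "G y v v = 1" "G y u v = 0"
        "\<And>w. W y u w = G y v w" "\<And>w. W y v w = - G y u w" for y u v
    proof -
      have Ju: "J y u = v" by (rule J(4)[OF y uv(4,5)])
      moreover from this have "J y v = - u" using J(2)[OF y, of u] by simp
      ultimately show ?thesis
        using uv(1-3) G'(2)[OF y, of v u]
        by (simp add: H_def bilinear_lneg[OF G'(1)[OF y]] bilinear_rneg[OF G'(1)[OF y]])
    qed
  qed
qed

section \<open>Components of the given tensor fields in a chart\<close>

definition local_rep ::
  "('a, 'e::euclidean_space) chart set \<Rightarrow> ('a, 'e) chart \<Rightarrow> ('a, 'e) tensor2 \<Rightarrow> 'e \<Rightarrow> 'e \<Rightarrow> 'e \<Rightarrow> real" where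
  "local_rep A c B y u v =
     B (chart_inv c y) (coord_tvec A c (chart_inv c y) u) (coord_tvec A c (chart_inv c y) v)"

lemma local_rep_coords:
  assumes "smooth_manifold A" "c \<in> A" "x \<in> chart_dom c" "u \<in> tangent_space A x" "v \<in> tangent_space A x"
  shows "local_rep A c B (chart_map c x) (u c) (v c) = B x u v"
  using assms by (simp add: local_rep_def chart_inv_chart_map coord_tvec_coords)

lemma coord_tvec_lincomb:
  assumes "smooth_manifold A" "c \<in> A" "x \<in> chart_dom c"
  shows "coord_tvec A c x (a *\<^sub>R u + b *\<^sub>R v) = lincomb a (coord_tvec A c x u) b (coord_tvec A c x v)"
  by (rule tangent_space_eqI[OF assms(2,3)])
     (simp_all add: lincomb_in_tangent_space coord_tvec_in_tangent_space assms,
      simp add: lincomb_def coord_tvec_same assms)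

lemma
  assumes A: "smooth_manifold A" "c \<in> A" and B: "smooth_tensor2 A (manifold_carrier A) B"
  shows bilinear_local_rep: "y \<in> chart_map c ` chart_dom c \<Longrightarrow> bilinear (local_rep A c B y)"
    and smooth_on_local_rep: "smooth_on (chart_map c ` chart_dom c) (\<lambda>y. local_rep A c B y u v)"
proof -
  assume "y \<in> chart_map c ` chart_dom c"
  then have x: "chart_inv c y \<in> chart_dom c" by (rule chart_inv_in_dom[OF A])
  then have "chart_inv c y \<in> manifold_carrier A" using A by (auto simp: manifold_carrier_def)
  note B' = B[unfolded smooth_tensor2_def, THEN conjunct1, rule_format, OF this,
      OF coord_tvec_in_tangent_space[OF A x] coord_tvec_in_tangent_space[OF A x]
         coord_tvec_in_tangent_space[OF A x]]
  have 1: "local_rep A c B y (a *\<^sub>R u + b *\<^sub>R v) w = a * local_rep A c B y u w + b * local_rep A c B y v w"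
    and 2: "local_rep A c B y w (a *\<^sub>R u + b *\<^sub>R v) = a * local_rep A c B y w u + b * local_rep A c B y w v"
    for a b u v w
    using B' by (simp_all add: local_rep_def coord_tvec_lincomb[OF A x])
  show "bilinear (local_rep A c B y)"
    unfolding bilinear_def
    \<comment> \<open>Additivity is the case of both coefficients 1, homogeneity that of second
      coefficient 0.\<close>
    using 1[of 1 _ 1] 2[of _ 1 _ 1] 1[of _ _ 0] 2[of _ _ _ 0] by (auto intro!: linearI)
next
  have "chart_map c ` (chart_dom c \<inter> manifold_carrier A) = chart_map c ` chart_dom c"
    using A by (auto simp: manifold_carrier_def)
  then show "smooth_on (chart_map c ` chart_dom c) (\<lambda>y. local_rep A c B y u v)"
    using B[unfolded smooth_tensor2_def, THEN conjunct2, rule_format, OF A(2), of u v]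
    by (simp add: local_rep_def)
qed

lemma comass_upper:
  assumes "comass A S g \<phi> = 1" "x \<in> S" "u \<in> tangent_space A x" "v \<in> tangent_space A x"
    "orthonormal_pair (g x) u v"
  shows "\<phi> x u v \<le> 1"
proof -
  have "ereal (\<phi> x u v) \<le> comass A S g \<phi>"
    unfolding comass_def using assms by (intro Sup_upper) blast
  then show ?thesis using assms(1) by simp
qed

section \<open>Oriented planes and holomorphic planes\<close>

lemma oriented_plane_of_subset:
  assumes "(u, v) \<in> oriented_plane_of u0 v0"
  shows "oriented_plane_of u v \<subseteq> oriented_plane_of u0 v0"
proof
  fix z assume "z \<in> oriented_plane_of u v"
  then obtain a b c d where z: "z = (lincomb a u b v, lincomb c u d v)" and D: "a * d - b * c > 0"
    by (auto simp: oriented_plane_of_def)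
  obtain p q r s where uv: "u = lincomb p u0 q v0" "v = lincomb r u0 s v0" and D': "p * s - q * r > 0"
    using assms by (auto simp: oriented_plane_of_def)
  have "z = (lincomb (a * p + b * r) u0 (a * q + b * s) v0, lincomb (c * p + d * r) u0 (c * q + d * s) v0)"
    by (simp add: z uv lincomb_def fun_eq_iff algebra_simps)
  moreover have "(a * p + b * r) * (c * q + d * s) - (a * q + b * s) * (c * p + d * r) > 0"
    using mult_pos_pos[OF D D'] by (simp add: algebra_simps)
  ultimately show "z \<in> oriented_plane_of u0 v0"
    by (auto simp: oriented_plane_of_def)
qed

text \<open>Change of basis with positive determinant is a group: determinants multiply, and the
  inverse matrix has determinant \<open>inverse \<delta>\<close>, again positive. Hence any
  positively oriented basis determines the plane.\<close>

lemma oriented_plane_of_eq: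
  assumes "(u, v) \<in> oriented_plane_of u0 v0"
  shows "oriented_plane_of u0 v0 = oriented_plane_of u v"
proof (rule antisym)
  obtain p q r s where uv: "u = lincomb p u0 q v0" "v = lincomb r u0 s v0" and D: "p * s - q * r > 0"
    using assms by (auto simp: oriented_plane_of_def)
  define \<delta> where "\<delta> = p * s - q * r"
  have "\<delta> > 0" using D by (simp add: \<delta>_def)
  have "s *\<^sub>R u c - q *\<^sub>R v c = \<delta> *\<^sub>R u0 c" "p *\<^sub>R v c - r *\<^sub>R u c = \<delta> *\<^sub>R v0 c" for c
    by (simp_all add: uv lincomb_def \<delta>_def algebra_simps)
  then have "inverse \<delta> *\<^sub>R (s *\<^sub>R u c - q *\<^sub>R v c) = u0 c" "inverse \<delta> *\<^sub>R (p *\<^sub>R v c - r *\<^sub>R u c) = v0 c" for c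
    using \<open>\<delta> > 0\<close> by simp_all
  then have "lincomb (inverse \<delta> * s) u (- (inverse \<delta> * q)) v = u0"
    "lincomb (- (inverse \<delta> * r)) u (inverse \<delta> * p) v = v0"
    by (simp_all add: lincomb_def fun_eq_iff algebra_simps)
  moreover have "inverse \<delta> * s * (inverse \<delta> * p) - - (inverse \<delta> * q) * - (inverse \<delta> * r)
      = inverse \<delta> * inverse \<delta> * \<delta>"
    by (simp add: \<delta>_def algebra_simps)
  then have "inverse \<delta> * s * (inverse \<delta> * p) - - (inverse \<delta> * q) * - (inverse \<delta> * r) > 0"
    using \<open>\<delta> > 0\<close> by simp
  ultimately have "(u0, v0) \<in> oriented_plane_of u v"
    unfolding oriented_plane_of_def by blast
  then show "oriented_plane_of u0 v0 \<subseteq> oriented_plane_of u v"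
    by (rule oriented_plane_of_subset)
qed (rule oriented_plane_of_subset[OF assms])

lemma self_in_oriented_plane_of: "(u, v) \<in> oriented_plane_of u v"
proof -
  have "(u, v) = (lincomb 1 u 0 v, lincomb 0 u 1 v)" "(1::real) * 1 - 0 * 0 > 0"
    by (simp_all add: lincomb_def)
  then show ?thesis unfolding oriented_plane_of_def by blast
qed

lemma plane_vectors_oriented_plane_of:
  "plane_vectors (oriented_plane_of u v) = {lincomb a u b v | a b. True}"
proof (intro set_eqI iffI)
  fix w assume "w \<in> plane_vectors (oriented_plane_of u v)"
  then obtain a b p q r s where
    "w = lincomb a (lincomb p u q v) b (lincomb r u s v)"
    by (auto simp: plane_vectors_def oriented_plane_of_def)
  then have "w = lincomb (a * p + b * r) u (a * q + b * s) v"
    by (simp add: lincomb_def fun_eq_iff algebra_simps)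
  then show "w \<in> {lincomb a u b v | a b. True}" by blast
next
  fix w assume "w \<in> {lincomb a u b v | a b. True}"
  then show "w \<in> plane_vectors (oriented_plane_of u v)"
    using self_in_oriented_plane_of[of u v] by (auto simp: plane_vectors_def)
qed

text \<open>For \<open>w\<close> with coefficients \<open>a, b\<close> the pair
  \<open>(w, j w)\<close> has the coefficient matrix with rows \<open>(a, b)\<close> and
  \<open>(- b, a)\<close>, whose determinant \<open>a * a + b * b\<close> is positive.\<close>

lemma holomorphic_plane_oriented_plane_of:
  assumes "\<And>a b. j (lincomb a u b v) = lincomb (- b) u a v"
  shows "holomorphic_plane j (oriented_plane_of u v)"
  unfolding holomorphic_plane_def plane_vectors_oriented_plane_of
proof (intro conjI ballI impI)
  fix w assume w: "w \<in> {lincomb a u b v | a b. True}"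
  then show "j w \<in> {lincomb a u b v | a b. True}"
    using assms by auto
  assume "w \<noteq> zero_tvec"
  from w obtain a b where ab: "w = lincomb a u b v" by blast
  with \<open>w \<noteq> zero_tvec\<close> have "a \<noteq> 0 \<or> b \<noteq> 0"
    by (auto simp: lincomb_def zero_tvec_def)
  then have "a * a - b * - b > 0"
    by (simp add: sum_squares_gt_zero_iff)
  then show "(w, j w) \<in> oriented_plane_of u v"
    unfolding ab assms oriented_plane_of_def by blast
qed

lemma chart_endo_rotation:
  assumes A: "smooth_manifold A" "c \<in> A" and x: "x \<in> chart_dom c"
    and uv: "u \<in> tangent_space A x" "v \<in> tangent_space A x"
    and J: "linear (J (chart_map c x))" "J (chart_map c x) (u c) = v c" "J (chart_map c x) (v c) = - u c"
  shows "chart_endo A c J x (lincomb a u b v) = lincomb (- b) u a v"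
proof -
  have "J (chart_map c x) (lincomb a u b v c) = lincomb (- b) u a v c"
    using J by (simp add: lincomb_def linear_add linear_cmul)
  then show ?thesis
    using coord_tvec_coords[OF A(2) x lincomb_in_tangent_space[OF A(1) uv]]
    by (simp add: chart_endo_def)
qed

section \<open>Calibrated planes in coordinates\<close>

lemma
  assumes A: "smooth_manifold A" "c \<in> A"
    and g: "riemannian_metric A (manifold_carrier A) g"
    and y: "y \<in> chart_map c ` chart_dom c"
  shows local_rep_sym: "local_rep A c g y u v = local_rep A c g y v u"
    and local_rep_pos: "u \<noteq> 0 \<Longrightarrow> local_rep A c g y u u > 0"
proof -
  have x: "chart_inv c y \<in> chart_dom c" by (rule chart_inv_in_dom[OF A y])
  then have x': "chart_inv c y \<in> manifold_carrier A" using A by (auto simp: manifold_carrier_def)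
  note T = coord_tvec_in_tangent_space[OF A x]
  show "local_rep A c g y u v = local_rep A c g y v u"
    using g x' T by (simp add: riemannian_metric_def local_rep_def)
  assume "u \<noteq> 0"
  then have "coord_tvec A c (chart_inv c y) u \<noteq> zero_tvec"
    using coord_tvec_same[OF A x, of u] by (auto simp: zero_tvec_def)
  then show "local_rep A c g y u u > 0"
    using g x' T by (simp add: riemannian_metric_def local_rep_def)
qed

text \<open>The basis that exhibits \<open>P\<close> as a plane is replaced by the orthonormal one
  that exhibits it as calibrated. For the latter the comass bound, transferred to the chart, gives
  the first-order conditions.\<close>

lemma calibrated_plane_local:
  assumes A: "smooth_manifold A" "c \<in> A"
    and g: "riemannian_metric A (manifold_carrier A) g"
    and \<omega>: "semi_calibration A (manifold_carrier A) g \<omega>"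
    and x: "x \<in> chart_dom c" and P: "P \<in> oriented_planes A x" "calibrated_plane (g x) (\<omega> x) P"
  defines "G \<equiv> local_rep A c g (chart_map c x)" and "W \<equiv> local_rep A c \<omega> (chart_map c x)"
  obtains u v where "u \<in> tangent_space A x" "v \<in> tangent_space A x" "P = oriented_plane_of u v"
    "G (u c) (u c) = 1" "G (v c) (v c) = 1" "G (u c) (v c) = 0"
    "\<And>w. W (u c) w = G (v c) w" "\<And>w. W (v c) w = - G (u c) w"
proof -
  obtain u0 v0 where uv0: "P = oriented_plane_of u0 v0" "u0 \<in> tangent_space A x" "v0 \<in> tangent_space A x"
    using P(1) by (auto simp: oriented_planes_def)
  obtain u v where uv: "(u, v) \<in> P" "orthonormal_pair (g x) u v" "\<omega> x u v = 1"
    using P(2) by (auto simp: calibrated_plane_def)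
  have T: "u \<in> tangent_space A x" "v \<in> tangent_space A x"
    using uv(1) uv0 lincomb_in_tangent_space[OF A(1)] by (auto simp: oriented_plane_of_def)
  have x': "x \<in> manifold_carrier A" using A x by (auto simp: manifold_carrier_def)
  have y: "chart_map c x \<in> chart_map c ` chart_dom c" using x by blast
  have smooth: "smooth_tensor2 A (manifold_carrier A) g" "smooth_tensor2 A (manifold_carrier A) \<omega>"
    using g \<omega> by (simp_all add: riemannian_metric_def semi_calibration_def two_form_def)
  note G = bilinear_local_rep[OF A smooth(1) y] local_rep_sym[OF A g y] local_rep_pos[OF A g y]
  note G = G[folded G_def]
  have W: "bilinear W" unfolding W_def by (rule bilinear_local_rep[OF A smooth(2) y])
  have coords: "G a b = g x (coord_tvec A c x a) (coord_tvec A c x b)"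
    "W a b = \<omega> x (coord_tvec A c x a) (coord_tvec A c x b)" for a b
    by (simp_all add: G_def W_def local_rep_def chart_inv_chart_map[OF A x])
  have le: "W a b \<le> 1" if "G a a = 1" "G b b = 1" "G a b = 0" for a b
    unfolding coords using that
    by (intro comass_upper[of A "manifold_carrier A" g] x' coord_tvec_in_tangent_space[OF A x])
       (use \<omega> in \<open>simp_all add: semi_calibration_def orthonormal_pair_def coords\<close>)
  have W0: "W a a = 0" for a
    using \<omega> x' coord_tvec_in_tangent_space[OF A x]
    by (simp add: coords semi_calibration_def two_form_def)
  have W_skew: "W b a = - W a b" for a b
    using W0[of "a + b"] W0[of a] W0[of b] by (simp add: bilinear_ladd[OF W] bilinear_radd[OF W])
  have uvc: "G (u c) (u c) = 1" "G (v c) (v c) = 1" "G (u c) (v c) = 0" "W (u c) (v c) = 1"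
    using uv(2,3) local_rep_coords[OF A x T(1,1)] local_rep_coords[OF A x T(1,2)]
      local_rep_coords[OF A x T(2,2)]
    by (simp_all add: G_def W_def orthonormal_pair_def)
  show ?thesis
  proof (rule that[OF T _ uvc(1-3)])
    show "P = oriented_plane_of u v"
      using oriented_plane_of_eq uv(1) uv0(1) by blast
    show "W (u c) w = G (v c) w" for w
      by (rule calibrated_pair_dual[OF G W le uvc W0])
    \<comment> \<open>The rotated pair \<open>v, - u\<close> spans the same oriented plane and is
      calibrated as well, so the duality applies to it too.\<close>
    have "W (v c) w = G (- u c) w" for w
      by (rule calibrated_pair_dual[OF G W le])
         (use uvc G(2)[of "v c" "u c"] W_skew[of "v c" "u c"] W0
          in \<open>simp_all add: bilinear_lneg[OF G(1)] bilinear_rneg[OF G(1)] bilinear_rneg[OF W]\<close>)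
    then show "W (v c) w = - G (u c) w" for w
      by (simp add: bilinear_lneg[OF G(1)])
  qed
qed

lemma calibrated_holomorphic_chart:
  assumes A: "smooth_manifold A" "c \<in> A" "x \<in> chart_dom c"
    and T: "u \<in> tangent_space A x" "v \<in> tangent_space A x"
    and "linear (J (chart_map c x))"
    and uv: "J (chart_map c x) (u c) = v c \<and> J (chart_map c x) (v c) = - u c \<and>
      H (chart_map c x) (u c) (u c) = 1 \<and> H (chart_map c x) (v c) (v c) = 1 \<and>
      H (chart_map c x) (u c) (v c) = 0"
  shows "calibrated_plane (chart_tensor c H x) (chart_tensor c (\<lambda>y u v. H y (J y u) v) x) (oriented_plane_of u v)"
    and "holomorphic_plane (chart_endo A c J x) (oriented_plane_of u v)"
proof -
  show "calibrated_plane (chart_tensor c H x) (chart_tensor c (\<lambda>y u v. H y (J y u) v) x) (oriented_plane_of u v)"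
    unfolding calibrated_plane_def
    by (rule bexI[OF _ self_in_oriented_plane_of])
       (use uv in \<open>simp add: orthonormal_pair_def chart_tensor_def\<close>)
  show "holomorphic_plane (chart_endo A c J x) (oriented_plane_of u v)"
    by (rule holomorphic_plane_oriented_plane_of, rule chart_endo_rotation[OF A T])
       (use assms in auto)
qed

subsection \<open>The product with a line\<close>

definition times_chart :: "('a, 'e) chart \<Rightarrow> ('a \<times> real, 'e \<times> real) chart" where
  "times_chart c = (chart_dom c \<times> UNIV, \<lambda>(x, t). (chart_map c x, t))"

lemma times_line_eq: "times_line A = times_chart ` A"
  by (simp add: times_line_def times_chart_def[abs_def])

lemma chart_dom_times_chart [simp]: "chart_dom (times_chart c) = chart_dom c \<times> UNIV"
  and chart_map_times_chart [simp]: "chart_map (times_chart c) (x, t) = (chart_map c x, t)"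
  by (simp_all add: times_chart_def)

lemma chart_map_times_chart_image:
  "chart_map (times_chart c) ` (S \<times> R) = (chart_map c ` S) \<times> R"
  by (force simp: times_chart_def)

lemma times_chart_inverse:
  assumes "smooth_manifold A" "c \<in> A" "y \<in> chart_map c ` chart_dom c"
  shows "chart_inv (times_chart c) (y, t) = (chart_inv c y, t)"
proof -
  have "inj_on (chart_map c) (chart_dom c)"
    using chart_inv_chart_map[OF assms(1,2)] by (metis inj_onI)
  then have "inj_on (chart_map (times_chart c)) (chart_dom (times_chart c))"
    by (auto simp: inj_on_def)
  moreover have "(chart_inv c y, t) \<in> chart_dom (times_chart c)"
    using chart_inv_in_dom[OF assms] by simp
  moreover have "chart_map (times_chart c) (chart_inv c y, t) = (y, t)"
    using chart_map_chart_inv[OF assms] by simp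
  ultimately show ?thesis
    unfolding chart_inv_def[of "times_chart c"] by (metis inv_into_f_f)
qed

lemma smooth_manifold_times_line:
  fixes A :: "('a::{t2_space,second_countable_topology}, 'e::euclidean_space) chart set"
  assumes "smooth_manifold A"
  shows "smooth_manifold (times_line A)"
  unfolding smooth_manifold_def times_line_eq ball_simps image_iff
proof (intro conjI ballI)
  fix c assume c: "c \<in> A"
  let ?c = "times_chart c"
  note inv = times_chart_inverse[OF assms c]
  have h: "homeomorphism (chart_dom c) (chart_map c ` chart_dom c) (chart_map c) (chart_inv c)"
    using assms c by (simp add: smooth_manifold_def)
  have image: "chart_map ?c ` chart_dom ?c = chart_map c ` chart_dom c \<times> UNIV"
    by (simp add: chart_map_times_chart_image)
  show "open (chart_dom ?c)"
    by (simp add: open_Times open_chart_dom[OF assms c])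
  show "open (chart_map ?c ` chart_dom ?c)"
    unfolding image by (intro open_Times open_UNIV open_chart_image[OF assms c] open_chart_dom[OF assms c]) simp
  have "continuous_on (chart_dom c \<times> UNIV) (\<lambda>z. (chart_map c (fst z), snd z))"
    by (intro continuous_on_Pair continuous_on_snd continuous_on_id
        continuous_on_compose2[OF homeomorphism_cont1[OF h] continuous_on_fst[OF continuous_on_id]]) auto
  then have 1: "continuous_on (chart_dom ?c) (chart_map ?c)"
    by (simp add: times_chart_def case_prod_beta')
  have "continuous_on (chart_map c ` chart_dom c \<times> UNIV) (\<lambda>z. (chart_inv c (fst z), snd z))"
    by (intro continuous_on_Pair continuous_on_snd continuous_on_id
        continuous_on_compose2[OF homeomorphism_cont2[OF h] continuous_on_fst[OF continuous_on_id]]) auto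
  then have 2: "continuous_on (chart_map ?c ` chart_dom ?c) (chart_inv ?c)"
    unfolding image by (rule continuous_on_cong[THEN iffD1, OF refl, rotated]) (auto simp: inv)
  have "chart_inv ?c (chart_map ?c z) = z" "chart_map ?c (chart_inv ?c (chart_map ?c z)) = chart_map ?c z"
    if "z \<in> chart_dom ?c" for z
    using that chart_inv_chart_map[OF assms c] by (cases z; simp add: inv)+
  then show "homeomorphism (chart_dom ?c) (chart_map ?c ` chart_dom ?c) (chart_map ?c) (chart_inv ?c)"
    using 1 2 by (intro homeomorphismI) auto
  fix d assume d: "d \<in> A"
  let ?d = "times_chart d" and ?S = "chart_map c ` (chart_dom c \<inter> chart_dom d)"
  have S: "chart_map ?c ` (chart_dom ?c \<inter> chart_dom ?d) = ?S \<times> UNIV"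
    by (simp add: chart_map_times_chart_image flip: Times_Int_distrib1)
  have oS: "open (?S \<times> (UNIV :: real set))"
    by (intro open_Times open_transition_domain[OF assms c d] open_UNIV)
  have fst: "smooth_on (?S \<times> (UNIV :: real set)) (\<lambda>z. (chart_map d \<circ> chart_inv c) (fst z))"
    by (rule smooth_on_compose[where h = fst, OF oS open_transition_domain[OF assms c d] _ smooth_on_transition[OF assms c d]
          smooth_on_bounded_linear[OF bounded_linear_fst]]) auto
  have bl: "bounded_linear (\<lambda>u :: 'e. (u, 0 :: real))" "bounded_linear (\<lambda>z :: 'e \<times> real. (0 :: 'e, snd z))"
    by (intro bounded_linear_Pair bounded_linear_ident bounded_linear_zero bounded_linear_snd)+
  \<comment> \<open>The product transition map is split into a part in each factor, so that sums and
    bounded linear maps suffice.\<close>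
  have "smooth_on (?S \<times> (UNIV :: real set)) (\<lambda>z. ((chart_map d \<circ> chart_inv c) (fst z), 0) + (0, snd z))"
    by (rule smooth_on_add[OF oS smooth_on_bounded_linear_comp[OF bl(1) oS fst]
          smooth_on_bounded_linear[OF bl(2)]])
  then show "smooth_on (chart_map ?c ` (chart_dom ?c \<inter> chart_dom ?d)) (chart_map ?d \<circ> chart_inv ?c)"
    unfolding S by (rule smooth_on_cong[OF oS, rotated]) (auto simp: inv)
qed

lemma transition_deriv_times_chart:
  assumes A: "smooth_manifold A" "c \<in> A" "d \<in> A" and x: "x \<in> chart_dom c" "x \<in> chart_dom d"
  shows "transition_deriv (times_chart c) (times_chart d) (x, t) (u, s) = (transition_deriv c d x u, s)"
proof -
  let ?S = "chart_map c ` (chart_dom c \<inter> chart_dom d) \<times> (UNIV :: real set)"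
  have oS: "open ?S" "chart_map (times_chart c) (x, t) \<in> ?S"
    using x by (auto intro!: open_Times open_transition_domain[OF A])
  have "((\<lambda>z. ((chart_map d \<circ> chart_inv c) (fst z), snd z)) has_derivative
      (\<lambda>z. (transition_deriv c d x (fst z), snd z))) (at (chart_map (times_chart c) (x, t)))"
    using has_derivative_transition[OF A x]
    by (intro has_derivative_Pair has_derivative_compose[OF has_derivative_fst[OF has_derivative_ident]]
        has_derivative_snd[OF has_derivative_ident]) (simp add: o_def)
  then have D: "((chart_map (times_chart d) \<circ> chart_inv (times_chart c)) has_derivative
      (\<lambda>z. (transition_deriv c d x (fst z), snd z))) (at (chart_map (times_chart c) (x, t)))"
    by (rule has_derivative_transform_within_open[OF _ oS]) (auto simp: times_chart_inverse[OF A(1,2)])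
  show ?thesis
    unfolding transition_deriv_def[of "times_chart c"] frechet_derivative_at[OF D, symmetric] by simp
qed

text \<open>\<open>differential\<close> picks its chart by \<open>SOME\<close>. Since the
  coordinates of \<open>v\<close> are compatible, the picked chart \<open>e\<close> may be exchanged
  for \<open>c\<close>; the transition maps of the product are the identity on the line.\<close>

lemma tangent_incl_eq_coord_tvec:
  assumes A: "smooth_manifold A" "c \<in> A" and x: "x \<in> chart_dom c" and v: "v \<in> tangent_space A x"
  shows "tangent_incl A x v = coord_tvec (times_line A) (times_chart c) (x, 0) (v c, 0)"
proof
  fix d'
  show "tangent_incl A x v d' = coord_tvec (times_line A) (times_chart c) (x, 0) (v c, 0) d'"
  proof (cases "d' \<in> times_line A \<and> (x, 0) \<in> chart_dom d'")
    case False
    then show ?thesis by (auto simp: tangent_incl_def differential_def coord_tvec_def)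
  next
    case True
    then obtain d where d: "d' = times_chart d" "d \<in> A" "x \<in> chart_dom d"
      by (auto simp: times_line_eq)
    define e where "e = (SOME c. c \<in> A \<and> x \<in> chart_dom c)"
    have e: "e \<in> A" "x \<in> chart_dom e"
      using someI[of "\<lambda>c. c \<in> A \<and> x \<in> chart_dom c" c] A x unfolding e_def by blast+
    have "((\<lambda>y. ((chart_map d \<circ> chart_inv e) y, 0 :: real)) has_derivative
        (\<lambda>u. (transition_deriv e d x u, 0))) (at (chart_map e x))"
      by (intro has_derivative_Pair has_derivative_transition[OF A(1) e(1) d(2) e(2) d(3)] has_derivative_const)
    then have D: "((chart_map d' \<circ> (\<lambda>y. (y, 0)) \<circ> chart_inv e) has_derivative
        (\<lambda>u. (transition_deriv e d x u, 0))) (at (chart_map e x))"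
      by (simp add: d(1) o_def)
    have "tangent_incl A x v d' = (transition_deriv e d x (v e), 0)"
      using True frechet_derivative_at[OF D, THEN fun_cong, of "v e"]
      by (simp add: tangent_incl_def differential_def Let_def flip: e_def)
    also have "\<dots> = (transition_deriv c d x (v c), 0)"
      using tangent_space_transition[OF v e d(2,3)] tangent_space_transition[OF v A(2) x d(2,3)] by simp
    also have "\<dots> = coord_tvec (times_line A) (times_chart c) (x, 0) (v c, 0) d'"
      using True transition_deriv_times_chart[OF A d(2) x d(3)] by (simp add: coord_tvec_def d(1))
    finally show ?thesis .
  qed
qed

text \<open>The inclusion is linear, so it carries bases to bases with the same coefficients and
  therefore the same determinant.\<close>

lemma plane_incl_oriented_plane_of:
  fixes A :: "('a::{t2_space,second_countable_topology}, 'e::euclidean_space) chart set"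
  assumes A: "smooth_manifold A" "c \<in> A" and x: "x \<in> chart_dom c"
    and uv: "u \<in> tangent_space A x" "v \<in> tangent_space A x"
  shows "plane_incl A x (oriented_plane_of u v) = oriented_plane_of (tangent_incl A x u) (tangent_incl A x v)"
proof -
  have A': "smooth_manifold (times_line A)" "times_chart c \<in> times_line A" "(x, 0) \<in> chart_dom (times_chart c)"
    using A x by (auto simp: times_line_eq smooth_manifold_times_line[unfolded times_line_eq])
  have lin: "tangent_incl A x (lincomb a u b v) = lincomb a (tangent_incl A x u) b (tangent_incl A x v)" for a b
    using coord_tvec_lincomb[OF A', of a "(u c, 0)" b "(v c, 0)"]
    by (simp add: tangent_incl_eq_coord_tvec[OF A x] uv lincomb_in_tangent_space[OF A(1)])
       (simp add: lincomb_def)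
  have "plane_incl A x (oriented_plane_of u v) =
      {map_prod (tangent_incl A x) (tangent_incl A x) (lincomb a u b v, lincomb c u d v) | a b c d.
        a * d - b * c > 0}"
    unfolding plane_incl_def oriented_plane_of_def
  proof (intro set_eqI iffI)
    fix z assume "z \<in> map_prod (tangent_incl A x) (tangent_incl A x) `
      {(lincomb a u b v, lincomb c u d v) | a b c d. a * d - b * c > 0}"
    then obtain w where "z = map_prod (tangent_incl A x) (tangent_incl A x) w"
      "w \<in> {(lincomb a u b v, lincomb c u d v) | a b c d. a * d - b * c > 0}"
      by (rule imageE)
    then show "z \<in> {map_prod (tangent_incl A x) (tangent_incl A x) (lincomb a u b v, lincomb c u d v) |
      a b c d. a * d - b * c > 0}"
      by blast
  next
    fix z assume "z \<in> {map_prod (tangent_incl A x) (tangent_incl A x) (lincomb a u b v, lincomb c u d v) |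
      a b c d. a * d - b * c > 0}"
    then obtain a b c d where
      z: "z = map_prod (tangent_incl A x) (tangent_incl A x) (lincomb a u b v, lincomb c u d v)"
      and D: "a * d - b * c > 0"
      by blast
    show "z \<in> map_prod (tangent_incl A x) (tangent_incl A x) `
      {(lincomb a u b v, lincomb c u d v) | a b c d. a * d - b * c > 0}"
      unfolding z by (rule imageI) (use D in blast)
  qed
  also have "\<dots> = oriented_plane_of (tangent_incl A x u) (tangent_incl A x v)"
    by (simp only: map_prod_simp lin oriented_plane_of_def)
  finally show ?thesis .
qed

theorem theorem1p1:
  fixes A :: "('a::{t2_space,second_countable_topology}, 'e::euclidean_space) chart set"
    and g \<omega> :: "('a, 'e) tensor2"
    and x0 :: 'a
  assumes "smooth_manifold A"
    and "riemannian_metric A (manifold_carrier A) g"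
    and "semi_calibration A (manifold_carrier A) g \<omega>"
    and "x0 \<in> manifold_carrier A"
  shows
    "(even DIM('e) \<longrightarrow>
       (\<exists>U (\<Omega> :: ('a, 'e) tensor2) (gJ :: ('a, 'e) tensor2) (J :: ('a, 'e) endo_field).
          open U \<and> x0 \<in> U \<and> U \<subseteq> manifold_carrier A \<and>
          two_form A U \<Omega> \<and> nondegenerate A U \<Omega> \<and> riemannian_metric A U gJ \<and>
          semi_calibration A U gJ \<Omega> \<and>
          uniquely_defines_acs A U \<Omega> gJ J \<and>
          (\<forall>x\<in>U. \<forall>P\<in>oriented_planes A x. calibrated_plane (g x) (\<omega> x) P \<longrightarrow>
             calibrated_plane (gJ x) (\<Omega> x) P \<and>
             holomorphic_plane (J x) P))) \<and>
     (odd DIM('e) \<longrightarrow>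
       (\<exists>U I (\<Omega> :: ('a \<times> real, 'e \<times> real) tensor2) (gJ :: ('a \<times> real, 'e \<times> real) tensor2)
          (J :: ('a \<times> real, 'e \<times> real) endo_field).
          open U \<and> x0 \<in> U \<and> U \<subseteq> manifold_carrier A \<and>
          open I \<and> is_interval I \<and> 0 \<in> I \<and>
          two_form (times_line A) (U \<times> I) \<Omega> \<and> nondegenerate (times_line A) (U \<times> I) \<Omega> \<and>
          riemannian_metric (times_line A) (U \<times> I) gJ \<and>
          semi_calibration (times_line A) (U \<times> I) gJ \<Omega> \<and>
          uniquely_defines_acs (times_line A) (U \<times> I) \<Omega> gJ J \<and>
          (\<forall>x\<in>U. \<forall>P\<in>oriented_planes A x. calibrated_plane (g x) (\<omega> x) P \<longrightarrow>
             calibrated_plane (gJ (x, 0)) (\<Omega> (x, 0)) (plane_incl A x P) \<and>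
             holomorphic_plane (J (x, 0)) (plane_incl A x P))))"
proof -
  obtain c where c: "c \<in> A" "x0 \<in> chart_dom c"
    using assms(4) by (auto simp: manifold_carrier_def)
  note A = assms(1) c(1)
  let ?V = "chart_map c ` chart_dom c" and ?G = "local_rep A c g" and ?W = "local_rep A c \<omega>"
  have V: "open ?V" "chart_map c x0 \<in> ?V"
    using open_chart_image[OF A order_refl open_chart_dom[OF A]] c(2) by auto
  have smooth: "smooth_tensor2 A (manifold_carrier A) g" "smooth_tensor2 A (manifold_carrier A) \<omega>"
    using assms(2,3) by (simp_all add: riemannian_metric_def semi_calibration_def two_form_def)
  note G = bilinear_local_rep[OF A smooth(1)] smooth_on_local_rep[OF A smooth(1)]
    local_rep_sym[OF A assms(2)] local_rep_pos[OF A assms(2)]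
  note W = bilinear_local_rep[OF A smooth(2)] smooth_on_local_rep[OF A smooth(2)]
  have U_carrier: "chart_inv c ` V' \<subseteq> manifold_carrier A" if "V' \<subseteq> ?V" for V'
    using chart_inv_imageD(1)[OF A that] A(2) by (auto simp: manifold_carrier_def)
  have x0_in: "x0 \<in> chart_inv c ` V'" if "chart_map c x0 \<in> V'" for V'
    using that chart_inv_chart_map[OF A c(2)] by (metis imageI)
  show ?thesis
  proof (intro conjI impI)
    assume "even DIM('e)"
    from ex_local_hermitian[OF this V G W]
    obtain V' H J where V': "open V'" "chart_map c x0 \<in> V'" "V' \<subseteq> ?V"
      and HJ: "\<And>y. y \<in> V' \<Longrightarrow> hermitian (H y) (J y)"
        "\<And>u v. smooth_on V' (\<lambda>y. H y u v)" "\<And>u. smooth_on V' (\<lambda>y. J y u)"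
      and cal: "\<And>y u v. y \<in> V' \<Longrightarrow> ?G y u u = 1 \<Longrightarrow> ?G y v v = 1 \<Longrightarrow> ?G y u v = 0 \<Longrightarrow>
        (\<And>w. ?W y u w = ?G y v w) \<Longrightarrow> (\<And>w. ?W y v w = - ?G y u w) \<Longrightarrow>
        J y u = v \<and> J y v = - u \<and> H y u u = 1 \<and> H y v v = 1 \<and> H y u v = 0"
      by blast
    let ?U = "chart_inv c ` V'"
    let ?\<Omega> = "chart_tensor c (\<lambda>y u v. H y (J y u) v)"
      and ?g = "chart_tensor c H" and ?J = "chart_endo A c J"
    have "V' \<noteq> {}" using V' by blast
    note S = semi_calibration_chart[OF A V'(1,3) this HJ]
    have P: "calibrated_plane (?g x) (?\<Omega> x) P \<and> holomorphic_plane (?J x) P"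
      if "x \<in> ?U" and P: "P \<in> oriented_planes A x" "calibrated_plane (g x) (\<omega> x) P" for x P
    proof -
      note x = chart_inv_imageD[OF A V'(3) that(1)]
      obtain u v where uv: "u \<in> tangent_space A x" "v \<in> tangent_space A x" "P = oriented_plane_of u v"
        and cal_uv: "?G (chart_map c x) (u c) (u c) = 1" "?G (chart_map c x) (v c) (v c) = 1"
          "?G (chart_map c x) (u c) (v c) = 0"
          "\<And>w. ?W (chart_map c x) (u c) w = ?G (chart_map c x) (v c) w"
          "\<And>w. ?W (chart_map c x) (v c) w = - ?G (chart_map c x) (u c) w"
        using calibrated_plane_local[OF A assms(2,3) x(1) P] by blast
      show ?thesis
        unfolding uv(3)
        by (intro conjI calibrated_holomorphic_chart[where J = J and H = H, OF A x(1) uv(1,2) hermitian_linear[OF HJ(1)[OF x(2)]]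
            cal[OF x(2) cal_uv]])
    qed
    show "\<exists>U (\<Omega> :: ('a, 'e) tensor2) (gJ :: ('a, 'e) tensor2) (J :: ('a, 'e) endo_field).
          open U \<and> x0 \<in> U \<and> U \<subseteq> manifold_carrier A \<and>
          two_form A U \<Omega> \<and> nondegenerate A U \<Omega> \<and> riemannian_metric A U gJ \<and>
          semi_calibration A U gJ \<Omega> \<and>
          uniquely_defines_acs A U \<Omega> gJ J \<and>
          (\<forall>x\<in>U. \<forall>P\<in>oriented_planes A x. calibrated_plane (g x) (\<omega> x) P \<longrightarrow>
             calibrated_plane (gJ x) (\<Omega> x) P \<and>
             holomorphic_plane (J x) P)"
      by (rule exI[of _ ?U], rule exI[of _ ?\<Omega>], rule exI[of _ ?g], rule exI[of _ ?J],
          intro conjI S open_chart_inv_image[OF A V'(3,1)] x0_in V' U_carrier)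
         (assumption | rule ballI impI P)+
  next
    assume "odd DIM('e)"
    then have even: "even DIM('e \<times> real)" by simp
    let ?c = "times_chart c"
    have A': "smooth_manifold (times_line A)" "?c \<in> times_line A"
      using smooth_manifold_times_line[OF assms(1)] c(1) by (auto simp: times_line_eq)
    \<comment> \<open>The line makes the dimension even. Its direction lies in the kernel of
      \<open>W'\<close>, which is harmless: the construction of \<open>J\<close> asks only for
      bilinearity and smoothness of that form.\<close>
    define G' where "G' y u v = ?G (fst y) (fst u) (fst v) + snd u * snd v"
      for y u v :: "'e \<times> real"
    define W' where "W' y u v = ?W (fst y) (fst u) (fst v)" for y u v :: "'e \<times> real"
    let ?V' = "?V \<times> (UNIV :: real set)"
    have oV': "open ?V'" "(chart_map c x0, 0) \<in> ?V'" using V by (auto intro: open_Times)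
    have smooth_fst: "smooth_on ?V' (\<lambda>y. f (fst y))" if "smooth_on ?V f" for f :: "'e \<Rightarrow> real"
      by (rule smooth_on_compose[where h = fst, OF oV'(1) V(1) _ that smooth_on_bounded_linear[OF bounded_linear_fst]]) auto
    have bil_fst: "bilinear (\<lambda>u v :: 'e \<times> real. B (fst u) (fst v))" if "bilinear B" for B :: "'e \<Rightarrow> 'e \<Rightarrow> real"
      unfolding bilinear_def
      by (auto intro!: linearI simp: bilinear_ladd[OF that] bilinear_radd[OF that] bilinear_lmul[OF that]
          bilinear_rmul[OF that])
    have bil_snd: "bilinear (\<lambda>u v :: 'e \<times> real. snd u * snd v)"
      unfolding bilinear_def by (auto intro!: linearI simp: algebra_simps)
    have W'_bil: "bilinear (W' y)" if "y \<in> ?V'" for y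
      unfolding W'_def[abs_def] using that by (intro bil_fst W(1)) auto
    have G'_bil: "bilinear (G' y)" if "y \<in> ?V'" for y
      using bil_fst[OF G(1), of "fst y"] bil_snd that unfolding G'_def[abs_def] bilinear_def
      by (auto intro!: linear_compose_add)
    have W'_smooth: "smooth_on ?V' (\<lambda>y. W' y u v)" for u v
      unfolding W'_def by (intro smooth_fst W(2))
    have G'_smooth: "smooth_on ?V' (\<lambda>y. G' y u v)" for u v
      unfolding G'_def by (intro smooth_on_add oV' smooth_fst G(2) smooth_on_const)
    have G'_sym: "G' y u v = G' y v u" if "y \<in> ?V'" for y u v
      using that G(3)[of "fst y" "fst u" "fst v"] by (auto simp: G'_def)
    have G'_pos: "G' y u u > 0" if "y \<in> ?V'" "u \<noteq> 0" for y u
    proof (cases "fst u = 0")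
      case True
      then have "snd u \<noteq> 0" using that(2) by (simp add: prod_eq_iff)
      moreover have "?G (fst y) 0 0 = 0" by (rule bilinear_lzero[OF G(1)]) (use that(1) in auto)
      ultimately show ?thesis using True by (simp add: G'_def flip: power2_eq_square)
    next
      case False
      then have "?G (fst y) (fst u) (fst u) > 0" using that(1) by (intro G(4)) auto
      then show ?thesis by (simp add: G'_def add_pos_nonneg)
    qed
    from ex_local_hermitian[OF even oV' G'_bil G'_smooth G'_sym G'_pos W'_bil W'_smooth]
    obtain N H J where N: "open N" "(chart_map c x0, 0) \<in> N" "N \<subseteq> ?V'"
      and HJ: "\<And>y. y \<in> N \<Longrightarrow> hermitian (H y) (J y)"
        "\<And>u v. smooth_on N (\<lambda>y. H y u v)" "\<And>u. smooth_on N (\<lambda>y. J y u)"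
      and cal: "\<And>y u v. y \<in> N \<Longrightarrow> G' y u u = 1 \<Longrightarrow> G' y v v = 1 \<Longrightarrow> G' y u v = 0 \<Longrightarrow>
        (\<And>w. W' y u w = G' y v w) \<Longrightarrow> (\<And>w. W' y v w = - G' y u w) \<Longrightarrow>
        J y u = v \<and> J y v = - u \<and> H y u u = 1 \<and> H y v v = 1 \<and> H y u v = 0"
      by blast
    \<comment> \<open>The complex structure lives on some neighbourhood \<open>N\<close> in the
      product; a box inside it, with its second side shrunk to a ball, gives the required form of a
      neighbourhood times an interval.\<close>
    obtain V1 I0 where VI: "open V1" "open I0" "chart_map c x0 \<in> V1" "0 \<in> I0" "V1 \<times> I0 \<subseteq> N"
      using open_prod_elim[OF N(1,2)] mem_Times_iff by (metis fst_conv snd_conv)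
    then obtain \<epsilon> where \<epsilon>: "\<epsilon> > 0" "ball 0 \<epsilon> \<subseteq> I0" by (auto elim: openE)
    define I where "I = ball (0 :: real) \<epsilon>"
    have I: "open I" "is_interval I" "0 \<in> I" using \<epsilon>(1) by (simp_all add: I_def is_interval_ball_real)
    let ?M = "V1 \<times> I"
    have M: "open ?M" "?M \<subseteq> N" "?M \<noteq> {}"
      using VI \<epsilon>(2) I by (auto simp: open_Times I_def)
    have V1: "V1 \<subseteq> ?V" using M(2) N(3) I(3) by blast
    have M': "?M \<subseteq> chart_map ?c ` chart_dom ?c"
      using V1 by (auto simp: chart_map_times_chart_image)
    let ?U = "chart_inv c ` V1"
    have UI: "chart_inv ?c ` ?M = ?U \<times> I"
    proof -
      have "chart_inv ?c z = (chart_inv c (fst z), snd z)" if "z \<in> ?M" for z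
        using times_chart_inverse[OF A, of "fst z" "snd z"] that V1 by auto
      then have "chart_inv ?c ` ?M = (\<lambda>z. (chart_inv c (fst z), snd z)) ` ?M"
        by (rule image_cong[OF refl])
      then show ?thesis by (force simp: image_iff)
    qed
    let ?\<Omega> = "chart_tensor ?c (\<lambda>y u v. H y (J y u) v)"
      and ?g = "chart_tensor ?c H" and ?J = "chart_endo (times_line A) ?c J"
    have HJ': "hermitian (H y) (J y)" if "y \<in> ?M" for y using HJ(1) that M(2) by blast
    note S = semi_calibration_chart[OF A' M(1) M' M(3) HJ' smooth_on_subset[OF HJ(2) M(2)]
        smooth_on_subset[OF HJ(3) M(2)], unfolded UI]
    have P: "calibrated_plane (?g (x, 0)) (?\<Omega> (x, 0)) (plane_incl A x P) \<and>
        holomorphic_plane (?J (x, 0)) (plane_incl A x P)"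
      if "x \<in> ?U" and P: "P \<in> oriented_planes A x" "calibrated_plane (g x) (\<omega> x) P" for x P
    proof -
      note x = chart_inv_imageD[OF A V1 that(1)]
      have x': "(x, 0) \<in> chart_dom ?c" "chart_map ?c (x, 0) \<in> N"
        using x I(3) M(2) by auto
      obtain u v where uv: "u \<in> tangent_space A x" "v \<in> tangent_space A x" "P = oriented_plane_of u v"
        and cal_uv: "?G (chart_map c x) (u c) (u c) = 1" "?G (chart_map c x) (v c) (v c) = 1"
          "?G (chart_map c x) (u c) (v c) = 0"
          "\<And>w. ?W (chart_map c x) (u c) w = ?G (chart_map c x) (v c) w"
          "\<And>w. ?W (chart_map c x) (v c) w = - ?G (chart_map c x) (u c) w"
        using calibrated_plane_local[OF A assms(2,3) x(1) P] by blast
      let ?i = "tangent_incl A x"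
      have i: "?i w \<in> tangent_space (times_line A) (x, 0)" "?i w ?c = (w c, 0)"
        if "w \<in> tangent_space A x" for w
        using tangent_incl_eq_coord_tvec[OF A x(1) that] coord_tvec_in_tangent_space[OF A' x'(1)]
          coord_tvec_same[OF A' x'(1)] by simp_all
      \<comment> \<open>The included vectors have line component 0, so \<open>G'\<close> and
        \<open>W'\<close> against any test vector reduce to \<open>g\<close> and
        \<open>\<omega>\<close> against its first component. The first-order conditions on
        \<open>M\<close> are thus already those on the product.\<close>
      have J_uv: "J (chart_map ?c (x, 0)) (?i u ?c) = ?i v ?c \<and> J (chart_map ?c (x, 0)) (?i v ?c) = - ?i u ?c \<and>
          H (chart_map ?c (x, 0)) (?i u ?c) (?i u ?c) = 1 \<and>
          H (chart_map ?c (x, 0)) (?i v ?c) (?i v ?c) = 1 \<and>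
          H (chart_map ?c (x, 0)) (?i u ?c) (?i v ?c) = 0"
        by (rule cal[OF x'(2)]) (use cal_uv in \<open>simp_all add: i uv G'_def W'_def\<close>)
      show ?thesis
        unfolding uv(3) plane_incl_oriented_plane_of[OF A x(1) uv(1,2)]
        by (intro conjI calibrated_holomorphic_chart[where J = J and H = H, OF A' x'(1) i(1)[OF uv(1)] i(1)[OF uv(2)]
            hermitian_linear[OF HJ(1)[OF x'(2)]] J_uv])
    qed
    show "\<exists>U I (\<Omega> :: ('a \<times> real, 'e \<times> real) tensor2) (gJ :: ('a \<times> real, 'e \<times> real) tensor2)
          (J :: ('a \<times> real, 'e \<times> real) endo_field).
          open U \<and> x0 \<in> U \<and> U \<subseteq> manifold_carrier A \<and>
          open I \<and> is_interval I \<and> 0 \<in> I \<and>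
          two_form (times_line A) (U \<times> I) \<Omega> \<and> nondegenerate (times_line A) (U \<times> I) \<Omega> \<and>
          riemannian_metric (times_line A) (U \<times> I) gJ \<and>
          semi_calibration (times_line A) (U \<times> I) gJ \<Omega> \<and>
          uniquely_defines_acs (times_line A) (U \<times> I) \<Omega> gJ J \<and>
          (\<forall>x\<in>U. \<forall>P\<in>oriented_planes A x. calibrated_plane (g x) (\<omega> x) P \<longrightarrow>
             calibrated_plane (gJ (x, 0)) (\<Omega> (x, 0)) (plane_incl A x P) \<and>
             holomorphic_plane (J (x, 0)) (plane_incl A x P))"
      by (rule exI[of _ ?U], rule exI[of _ I], rule exI[of _ ?\<Omega>], rule exI[of _ ?g], rule exI[of _ ?J],
          intro conjI S I open_chart_inv_image[OF A V1 VI(1)] x0_in VI(3) U_carrier[OF V1])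
         (assumption | rule ballI impI P)+
  qed
qed

end
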